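(* Let $\mathbb{B}$ be a complex $4$-dimensional binary $(-1,1)$-algebra. Then $\mathbb{B}$ is a $(-1,1)$-algebra or it is isomorphic to one of the following algebras (given in a basis $e_1,e_2,e_3,e_4$; all products of basis elements not listed are zero; $\alpha\in\mathbb{C}$): $\mathbb{B}_{01}$: $e_1e_1=2e_1$, $e_1e_2=2e_2$, $e_1e_3=2e_3$, $e_1e_4=2e_4$, $e_4e_1=2e_4$, $e_2e_3=e_4$, $e_3e_2=-e_4$, $e_3e_3=-e_4$; $\mathbb{B}_{02}^{\alpha}$: $e_1e_1=2e_1$, $e_1e_2=2e_2$, $e_1e_3=2e_3$, $e_1e_4=2e_4$, $e_4e_1=2e_4$, $e_2e_3=(\alpha+1)e_4$, $e_3e_2=(\alpha-1)e_4$; $\mathbb{B}_{03}$: $e_1e_1=2e_1$, $e_1e_2=2e_2+e_4$, $e_2e_1=e_4$, $e_1e_3=2e_3$, $e_1e_4=2e_4$, $e_4e_1=2e_4$, $e_2e_3=2e_4$; $\mathbb{B}_{04}$: $e_1e_1=2e_1$, $e_2e_1=2e_2$, $e_3e_1=2e_3$, $e_2e_3=e_4$, $e_3e_2=-e_4$, $e_3e_3=-e_4$; $\mathbb{B}_{05}^{\alpha}$: $e_1e_1=2e_1$, $e_2e_1=2e_2$, $e_3e_1=2e_3$, $e_2e_3=(\alpha+1)e_4$, $e_3e_2=(\alpha-1)e_4$; $\mathbb{B}_{06}$: $e_1e_1=2e_1$, $e_1e_2=-e_4$, $e_2e_1=2e_2-e_4$, $e_3e_1=2e_3$, $e_2e_3=2e_4$;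 $\mathbb{B}_{07}$: $e_1e_1=2e_1$, $e_1e_2=2e_2$, $e_1e_3=2e_3$, $e_4e_1=2e_4$, $e_2e_3=e_4$, $e_3e_2=-e_4$; $\mathbb{B}_{08}$: $e_1e_1=2e_1$, $e_2e_1=2e_2$, $e_3e_1=2e_3$, $e_1e_4=2e_4$, $e_2e_3=e_4$, $e_3e_2=-e_4$. All listed algebras are pairwise non-isomorphic, except that $\mathbb{B}_{02}^{\alpha}\cong\mathbb{B}_{02}^{-\alpha}$ and $\mathbb{B}_{05}^{\alpha}\cong\mathbb{B}_{05}^{-\alpha}$.
   Context: Write $(x,y,z)=(xy)z-x(yz)$. An algebra is right alternative if $(x,y,z)=-(x,z,y)$ for all $x,y,z$. A $(-1,1)$-algebra is a right alternative algebra satisfying $(x,y,z)+(y,z,x)+(z,x,y)=0$ for all $x,y,z$. An algebra is a binary $(-1,1)$-algebra if each of its subalgebras generated by two elements is a $(-1,1)$-algebra. *)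

theory Defs
  imports "HOL-Analysis.Cartesian_Space"
begin

text \<open>Algebras are neither assumed associative nor unital.\<close>

locale complex_algebra = vector_space scl
  for scl :: "complex \<Rightarrow> 'a::ab_group_add \<Rightarrow> 'a" +
  fixes mult :: "'a \<Rightarrow> 'a \<Rightarrow> 'a"
  assumes linear_mult_right: "Vector_Spaces.linear scl scl (\<lambda>y. mult x y)"
    and linear_mult_left: "Vector_Spaces.linear scl scl (\<lambda>x. mult x y)"

definition associator :: "('a \<Rightarrow> 'a \<Rightarrow> 'a) \<Rightarrow> 'a \<Rightarrow> 'a \<Rightarrow> 'a \<Rightarrow> 'a::ab_group_add" where
  "associator mult x y z = mult (mult x y) z - mult x (mult y z)"

text \<open>The set \<open>S\<close> below is the carrier of a subalgebra, or \<open>UNIV\<close> for the whole algebra.\<close>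

definition right_alternative_on :: "'a set \<Rightarrow> ('a \<Rightarrow> 'a \<Rightarrow> 'a::ab_group_add) \<Rightarrow> bool" where
  "right_alternative_on S mult \<longleftrightarrow>
     (\<forall>x\<in>S. \<forall>y\<in>S. \<forall>z\<in>S. associator mult x y z = - associator mult x z y)"

definition minus_one_one_on :: "'a set \<Rightarrow> ('a \<Rightarrow> 'a \<Rightarrow> 'a::ab_group_add) \<Rightarrow> bool" where
  "minus_one_one_on S mult \<longleftrightarrow> right_alternative_on S mult \<and>
     (\<forall>x\<in>S. \<forall>y\<in>S. \<forall>z\<in>S.
        associator mult x y z + associator mult y z x + associator mult z x y = 0)"

definition is_subalgebra ::
  "(complex \<Rightarrow> 'a \<Rightarrow> 'a) \<Rightarrow> ('a \<Rightarrow> 'a \<Rightarrow> 'a) \<Rightarrow> 'a::ab_group_add set \<Rightarrow> bool" where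
  "is_subalgebra scl mult S \<longleftrightarrow>
     module.subspace scl S \<and> (\<forall>x\<in>S. \<forall>y\<in>S. mult x y \<in> S)"

definition generated_subalgebra ::
  "(complex \<Rightarrow> 'a \<Rightarrow> 'a) \<Rightarrow> ('a \<Rightarrow> 'a \<Rightarrow> 'a) \<Rightarrow> 'a set \<Rightarrow> 'a::ab_group_add set" where
  "generated_subalgebra scl mult X = \<Inter> {S. is_subalgebra scl mult S \<and> X \<subseteq> S}"

definition binary_minus_one_one ::
  "(complex \<Rightarrow> 'a \<Rightarrow> 'a) \<Rightarrow> ('a \<Rightarrow> 'a \<Rightarrow> 'a::ab_group_add) \<Rightarrow> bool" where
  "binary_minus_one_one scl mult \<longleftrightarrow>
     (\<forall>a b. minus_one_one_on (generated_subalgebra scl mult {a, b}) mult)"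

definition isomorphic_algebras ::
  "(complex \<Rightarrow> 'a \<Rightarrow> 'a) \<Rightarrow> ('a \<Rightarrow> 'a \<Rightarrow> 'a::ab_group_add) \<Rightarrow>
   (complex \<Rightarrow> 'b \<Rightarrow> 'b) \<Rightarrow> ('b \<Rightarrow> 'b \<Rightarrow> 'b::ab_group_add) \<Rightarrow> bool" where
  "isomorphic_algebras scl\<^sub>1 mult\<^sub>1 scl\<^sub>2 mult\<^sub>2 \<longleftrightarrow>
     (\<exists>f. Vector_Spaces.linear scl\<^sub>1 scl\<^sub>2 f \<and> bij f \<and>
          (\<forall>x y. f (mult\<^sub>1 x y) = mult\<^sub>2 (f x) (f y)))"

text \<open>In the index type \<open>4\<close> the numeral \<open>4\<close> equals \<open>0\<close>,
  so \<open>1, 2, 3, 4\<close> are exactly its four elements.\<close>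

abbreviation \<e> :: "4 \<Rightarrow> complex ^ 4" where
  "\<e> i \<equiv> axis i 1"

definition mult_of_table :: "(4 \<times> 4 \<Rightarrow> complex ^ 4) \<Rightarrow> complex ^ 4 \<Rightarrow> complex ^ 4 \<Rightarrow> complex ^ 4"
  where "mult_of_table T x y = (\<Sum>i\<in>UNIV. \<Sum>j\<in>UNIV. (x $ i * y $ j) *s T (i, j))"

datatype label = B01 | B02 complex | B03 | B04 | B05 complex | B06 | B07 | B08

fun table :: "label \<Rightarrow> 4 \<times> 4 \<Rightarrow> complex ^ 4" where
  "table B01 = (\<lambda>_. 0)(
     (1, 1) := 2 *s \<e> 1, (1, 2) := 2 *s \<e> 2, (1, 3) := 2 *s \<e> 3, (1, 4) := 2 *s \<e> 4,
     (4, 1) := 2 *s \<e> 4, (2, 3) := \<e> 4, (3, 2) := - \<e> 4, (3, 3) := - \<e> 4)"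
| "table (B02 \<alpha>) = (\<lambda>_. 0)(
     (1, 1) := 2 *s \<e> 1, (1, 2) := 2 *s \<e> 2, (1, 3) := 2 *s \<e> 3, (1, 4) := 2 *s \<e> 4,
     (4, 1) := 2 *s \<e> 4, (2, 3) := (\<alpha> + 1) *s \<e> 4, (3, 2) := (\<alpha> - 1) *s \<e> 4)"
| "table B03 = (\<lambda>_. 0)(
     (1, 1) := 2 *s \<e> 1, (1, 2) := 2 *s \<e> 2 + \<e> 4, (2, 1) := \<e> 4, (1, 3) := 2 *s \<e> 3,
     (1, 4) := 2 *s \<e> 4, (4, 1) := 2 *s \<e> 4, (2, 3) := 2 *s \<e> 4)"
| "table B04 = (\<lambda>_. 0)(
     (1, 1) := 2 *s \<e> 1, (2, 1) := 2 *s \<e> 2, (3, 1) := 2 *s \<e> 3,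
     (2, 3) := \<e> 4, (3, 2) := - \<e> 4, (3, 3) := - \<e> 4)"
| "table (B05 \<alpha>) = (\<lambda>_. 0)(
     (1, 1) := 2 *s \<e> 1, (2, 1) := 2 *s \<e> 2, (3, 1) := 2 *s \<e> 3,
     (2, 3) := (\<alpha> + 1) *s \<e> 4, (3, 2) := (\<alpha> - 1) *s \<e> 4)"
| "table B06 = (\<lambda>_. 0)(
     (1, 1) := 2 *s \<e> 1, (1, 2) := - \<e> 4, (2, 1) := 2 *s \<e> 2 - \<e> 4, (3, 1) := 2 *s \<e> 3,
     (2, 3) := 2 *s \<e> 4)"
| "table B07 = (\<lambda>_. 0)(
     (1, 1) := 2 *s \<e> 1, (1, 2) := 2 *s \<e> 2, (1, 3) := 2 *s \<e> 3, (4, 1) := 2 *s \<e> 4,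
     (2, 3) := \<e> 4, (3, 2) := - \<e> 4)"
| "table B08 = (\<lambda>_. 0)(
     (1, 1) := 2 *s \<e> 1, (2, 1) := 2 *s \<e> 2, (3, 1) := 2 *s \<e> 3, (1, 4) := 2 *s \<e> 4,
     (2, 3) := \<e> 4, (3, 2) := - \<e> 4)"

definition listed_mult :: "label \<Rightarrow> complex ^ 4 \<Rightarrow> complex ^ 4 \<Rightarrow> complex ^ 4" where
  "listed_mult L = mult_of_table (table L)"

end

(*
  In a right alternative algebra the cyclic sum S(x,y,z) of associators is alternating, and the
  binary identity gives S(a,b,ab) = 0. If S does not vanish, some coordinate of S is a nonzero
  alternating 3-form on a 4-dimensional space; let c span its kernel. Then ab lies in
  span(a,b,c), which forces ab = f(a) b + g(b) a + h(a,b) c with f, g linear and h bilinear.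
  Right alternativity leaves two possibilities for non-vanishing S: one of f, g is zero, and with
  k = f - g one has k(c) = 0, h(c,.) = k and either h(.,c) = 0, or h(.,c) = -k and h alternating.
  Choosing e with k(e) = 2 and a basis u, v of ker k modulo c in which the quadratic form h(x,x)
  is normalised gives the list. Conversely an isomorphism of listed algebras respects f and g and
  maps h to a multiple of h; the determinant of h on span(e2,e3), its symmetric part, the form
  h(.,c) and the values h(e,.) for k(e) = 2 separate the algebras.
*)
theory Submission
  imports Defs
begin

section \<open>Isomorphisms and multiplication tables\<close>

text \<open>The binary hypothesis is used through pairs x, y only: (x,y,y) = 0, whose polarisation
  is right alternativity on the whole algebra, and S(a,b,ab) = 0, because ab lies in the subalgebra
  generated by a and b. Skewness in the last two arguments makes the cyclic sum S alternating. In
  dimension 4 a nonzero alternating 3-form is the volume form contracted with a vector c; in a basis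
  ending with c it is a multiple of the determinant of the first three coordinates. So S(a,b,ab) = 0
  becomes a system of linear equations in the structure constants. Once h(c,.) = k is known, S is k
  wedge the skew part of h, times c and a factor 1 or 3/2. That S does not vanish therefore yields e
  with k(e) = 2 and u, v in ker k on which the skew part of h has a nonzero value 2r; taking r c as
  fourth basis vector fixes all scales. What remains to normalise is a binary quadratic form, the
  symmetric part of h on u, v, together with the values of h on pairs containing e.\<close>

lemma isomorphic_algebras_sym:
  assumes "complex_algebra scl1 mult1" "complex_algebra scl2 mult2"
    and "isomorphic_algebras scl1 mult1 scl2 mult2"
  shows "isomorphic_algebras scl2 mult2 scl1 mult1"
proof -
  interpret A: complex_algebra scl1 mult1 by fact
  interpret B: complex_algebra scl2 mult2 by fact
  interpret vector_space_pair scl1 scl2 by unfold_locales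
  obtain f where f: "Vector_Spaces.linear scl1 scl2 f" "bij f"
    "\<And>x y. f (mult1 x y) = mult2 (f x) (f y)"
    using assms(3) unfolding isomorphic_algebras_def by blast
  have [simp]: "f (inv f x) = x" for x using f(2) by (simp add: bij_is_surj surj_f_inv_f)
  have inv_eqI: "inv f y = x" if "f x = y" for x y
    using that f(2) by (metis bij_inv_eq_iff)
  note fl = linear_add[OF f(1)] linear_scale[OF f(1)]
  have "Vector_Spaces.linear scl2 scl1 (inv f)"
    by unfold_locales (auto intro!: inv_eqI simp: fl)
  moreover have "inv f (mult2 x y) = mult1 (inv f x) (inv f y)" for x y
    by (rule inv_eqI) (simp add: f(3))
  moreover have "bij (inv f)" using f(2) by (rule bij_imp_bij_inv)
  ultimately show ?thesis unfolding isomorphic_algebras_def by blast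
qed

lemma isomorphic_algebras_trans:
  assumes "isomorphic_algebras scl1 mult1 scl2 mult2"
    and "isomorphic_algebras scl2 mult2 scl3 mult3"
  shows "isomorphic_algebras scl1 mult1 scl3 mult3"
proof -
  obtain f where f: "Vector_Spaces.linear scl1 scl2 f" "bij f"
    "\<And>x y. f (mult1 x y) = mult2 (f x) (f y)"
    using assms(1) unfolding isomorphic_algebras_def by blast
  obtain g where g: "Vector_Spaces.linear scl2 scl3 g" "bij g"
    "\<And>x y. g (mult2 x y) = mult3 (g x) (g y)"
    using assms(2) unfolding isomorphic_algebras_def by blast
  have "Vector_Spaces.linear scl1 scl3 (g \<circ> f)"
    by (rule Vector_Spaces.linear_compose[OF f(1) g(1)])
  moreover have "bij (g \<circ> f)" using f(2) g(2) by (rule bij_comp)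
  ultimately show ?thesis
    unfolding isomorphic_algebras_def using f(3) g(3) by (auto intro!: exI[of _ "g \<circ> f"])
qed

lemma isomorphic_algebras_refl:
  assumes "complex_algebra scl mult"
  shows "isomorphic_algebras scl mult scl mult"
proof -
  interpret complex_algebra scl mult by fact
  show ?thesis
    unfolding isomorphic_algebras_def by (intro exI[of _ id]) (auto simp: linear_id)
qed

lemma complex_algebra_mult_of_table: "complex_algebra (*s) (mult_of_table T)"
proof
  show "mult_of_table T x (b1 + b2) = mult_of_table T x b1 + mult_of_table T x b2" for x b1 b2
    by (simp add: mult_of_table_def algebra_simps vec_eq_iff sum.distrib)
  show "mult_of_table T (b1 + b2) x = mult_of_table T b1 x + mult_of_table T b2 x" for x b1 b2
    by (simp add: mult_of_table_def algebra_simps vec_eq_iff sum.distrib)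
  show "mult_of_table T x (r *s b) = r *s mult_of_table T x b" for x r b
    by (simp add: mult_of_table_def vec_eq_iff sum_distrib_left mult_ac)
  show "mult_of_table T (r *s b) x = r *s mult_of_table T b x" for x r b
    by (simp add: mult_of_table_def vec_eq_iff sum_distrib_left mult_ac)
qed

lemma mult_of_table_axis: "mult_of_table T (\<e> i) (\<e> j) = T (i, j)"
proof -
  have "mult_of_table T (\<e> i) (\<e> j) =
    (\<Sum>k\<in>UNIV. \<Sum>l\<in>UNIV. if k = i then (if l = j then T (k, l) else 0) else 0)"
    unfolding mult_of_table_def
    by (intro sum.cong refl) (auto simp: axis_def vec_eq_iff)
  also have "\<dots> = (\<Sum>k\<in>UNIV. if k = i then T (i, j) else 0)"
    by (intro sum.cong refl) simp
  finally show ?thesis by simp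
qed

section \<open>Coordinates with respect to a basis\<close>

definition basis_map :: "(complex \<Rightarrow> 'a \<Rightarrow> 'a) \<Rightarrow> (4 \<Rightarrow> 'a) \<Rightarrow> complex ^ 4 \<Rightarrow> 'a::ab_group_add" where
  "basis_map scl b x = (\<Sum>i\<in>UNIV. scl (x $ i) (b i))"

context complex_algebra
begin

lemma mult_add_left: "mult (x + y) z = mult x z + mult y z"
  and mult_add_right: "mult z (x + y) = mult z x + mult z y"
  and mult_scale_left: "mult (scl r x) z = scl r (mult x z)"
  and mult_scale_right: "mult z (scl r x) = scl r (mult z x)"
proof -
  interpret vector_space_pair scl scl by unfold_locales
  show "mult (x + y) z = mult x z + mult y z" "mult z (x + y) = mult z x + mult z y"
    "mult (scl r x) z = scl r (mult x z)" "mult z (scl r x) = scl r (mult z x)"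
    using linear_add[OF linear_mult_left] linear_add[OF linear_mult_right]
      linear_scale[OF linear_mult_left] linear_scale[OF linear_mult_right] by auto
qed

lemma mult_zero_left: "mult 0 x = 0" and mult_zero_right: "mult x 0 = 0"
  using mult_scale_left[of 0 0 x] mult_scale_right[of x 0 0] by simp_all

lemma mult_sum_left: "mult (sum f A) x = (\<Sum>i\<in>A. mult (f i) x)"
  by (induction A rule: infinite_finite_induct) (simp_all add: mult_zero_left mult_add_left)

lemma mult_sum_right: "mult x (sum f A) = (\<Sum>i\<in>A. mult x (f i))"
  by (induction A rule: infinite_finite_induct) (simp_all add: mult_zero_right mult_add_right)

lemma linear_basis_map: "Vector_Spaces.linear (*s) scl (basis_map scl b)"
  by unfold_locales (simp_all add: basis_map_def algebra_simps sum.distrib scale_sum_right)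

lemma exists_table:
  assumes bij: "bij (basis_map scl b)"
  obtains T where
    "\<And>x y. basis_map scl b (mult_of_table T x y) = mult (basis_map scl b x) (basis_map scl b y)"
    "isomorphic_algebras scl mult (*s) (mult_of_table T)"
proof -
  interpret P: vector_space_pair "(*s)" scl by unfold_locales
  note lin = linear_basis_map[of b]
  define T where "T = (\<lambda>(i, j). inv (basis_map scl b) (mult (b i) (b j)))"
  have T: "basis_map scl b (T (i, j)) = mult (b i) (b j)" for i j
    using bij by (simp add: T_def bij_is_surj surj_f_inv_f)
  have hom: "basis_map scl b (mult_of_table T x y) = mult (basis_map scl b x) (basis_map scl b y)" for x y
  proof -
    have "basis_map scl b (mult_of_table T x y) =
      (\<Sum>i\<in>UNIV. \<Sum>j\<in>UNIV. scl (x $ i * y $ j) (mult (b i) (b j)))"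
      by (simp add: mult_of_table_def P.linear_sum[OF lin] P.linear_scale[OF lin] T)
    also have "\<dots> = mult (basis_map scl b x) (basis_map scl b y)"
      unfolding basis_map_def[of _ b]
      by (subst sum.swap)
        (simp add: mult_sum_left mult_sum_right mult_scale_left mult_scale_right scale_sum_right
          mult.commute)
    finally show ?thesis .
  qed
  then have "isomorphic_algebras (*s) (mult_of_table T) scl mult"
    unfolding isomorphic_algebras_def using bij lin by blast
  then show thesis
    by (rule that[OF hom isomorphic_algebras_sym[OF complex_algebra_mult_of_table complex_algebra_axioms]])
qed

lemma bij_basis_map_of_dim:
  assumes "dim UNIV = 4"
  obtains b where "bij (basis_map scl b)"
proof -
  obtain B where B: "independent B" "UNIV \<subseteq> span B" "card B = 4"
    using basis_exists[of UNIV] assms by metis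
  then have fin: "finite B" using card.infinite by fastforce
  obtain b :: "4 \<Rightarrow> 'a" where b: "bij_betw b UNIV B"
    using finite_same_card_bij[of "UNIV :: 4 set" B] fin B(3) by auto
  interpret P: vector_space_pair "(*s) :: complex \<Rightarrow> complex ^ 4 \<Rightarrow> _" scl by unfold_locales
  have reidx: "basis_map scl b x = (\<Sum>v\<in>B. scl (x $ inv b v) v)" for x
    unfolding basis_map_def using sum.reindex_bij_betw[OF b, of "\<lambda>v. scl (x $ inv b v) v"] b
    by (simp add: bij_betw_def inv_f_f)
  have "inj (basis_map scl b)"
  proof (subst P.linear_inj_iff_eq_0[OF linear_basis_map], intro allI impI)
    fix x assume "basis_map scl b x = 0"
    then have "x $ inv b v = 0" if "v \<in> B" for v
      using independentD[OF B(1) fin subset_refl, of "\<lambda>v. x $ inv b v" v] that reidx by simp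
    then have "x $ i = 0" for i
      using b by (metis UNIV_I bij_betw_def inv_f_f imageI)
    then show "x = 0" by (simp add: vec_eq_iff)
  qed
  moreover have "y \<in> range (basis_map scl b)" for y
  proof -
    obtain r where "y = (\<Sum>v\<in>B. scl (r v) v)"
      using B(2) span_finite[OF fin] by auto
    also have "\<dots> = basis_map scl b (\<chi> i. r (b i))"
      unfolding basis_map_def using sum.reindex_bij_betw[OF b, of "\<lambda>v. scl (r v) v"] by simp
    finally show ?thesis by blast
  qed
  ultimately show thesis using that by (auto simp: bij_def)
qed

end

section \<open>Products with values in the span of the factors and a fixed vector\<close>

locale bilinear_form =
  fixes h :: "complex ^ 4 \<Rightarrow> complex ^ 4 \<Rightarrow> complex"
  assumes h_add_left [simp]: "h (x + y) z = h x z + h y z"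
    and h_scale_left [simp]: "h (r *s x) z = r * h x z"
    and h_add_right [simp]: "h z (x + y) = h z x + h z y"
    and h_scale_right [simp]: "h z (r *s x) = r * h z x"
begin

lemma h_minus [simp]: "h (- x) z = - h x z" "h z (- x) = - h z x"
  using h_scale_left[of "- 1" x z] h_scale_right[of z "- 1" x] by simp_all

lemma h_diff [simp]: "h (x - y) z = h x z - h y z" "h z (x - y) = h z x - h z y"
  using h_add_left[of x "- y" z] h_add_right[of z x "- y"] by simp_all

lemma h_zero [simp]: "h 0 z = 0" "h z 0 = 0"
  using h_scale_left[of 0 0 z] h_scale_right[of z 0 0] by simp_all

end

locale form_algebra = bilinear_form h
  for f g :: "complex ^ 4 \<Rightarrow> complex" and h :: "complex ^ 4 \<Rightarrow> complex ^ 4 \<Rightarrow> complex" +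
  assumes f_add [simp]: "f (x + y) = f x + f y" and f_scale [simp]: "f (r *s x) = r * f x"
    and g_add [simp]: "g (x + y) = g x + g y" and g_scale [simp]: "g (r *s x) = r * g x"
begin

definition mul :: "complex ^ 4 \<Rightarrow> complex ^ 4 \<Rightarrow> complex ^ 4" where
  "mul a b = f a *s b + g b *s a + h a b *s \<e> 4"

text \<open>There is no term in \<open>b\<close>: both bracketings contribute
  \<open>f a * g d\<close> times \<open>b\<close>, and these cancel.\<close>

lemma associator_mul:
  "associator mul a b d =
    (f a * g b + h a b * f (\<e> 4)) *s d - (f b * g d + h b d * g (\<e> 4)) *s a
    + (h a d * (g b - f b) + h a b * h (\<e> 4) d - h b d * h a (\<e> 4)) *s \<e> 4"
  by (simp add: associator_def mul_def vec_eq_iff algebra_simps)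

end

text \<open>The volume form contracted with e_4; it vanishes exactly when x, y, z, e_4 are linearly
  dependent.\<close>

definition det3 :: "complex ^ 4 \<Rightarrow> complex ^ 4 \<Rightarrow> complex ^ 4 \<Rightarrow> complex" where
  "det3 x y z = x $ 1 * (y $ 2 * z $ 3 - y $ 3 * z $ 2)
    + x $ 2 * (y $ 3 * z $ 1 - y $ 1 * z $ 3) + x $ 3 * (y $ 1 * z $ 2 - y $ 2 * z $ 1)"

text \<open>A permutation of the first three coordinates changes \<open>det3\<close> only by a sign.
  This lets each relation between structure constants be derived once, for arbitrary
  indices.\<close>

lemma det3_eq_0_permute:
  assumes "distinct [i, j, k, 4 :: 4]" "det3 x y z = 0"
  shows "x $ i * (y $ j * z $ k - y $ k * z $ j)
    + x $ j * (y $ k * z $ i - y $ i * z $ k) + x $ k * (y $ i * z $ j - y $ j * z $ i) = 0"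
  using assms exhaust_4[of i] exhaust_4[of j] exhaust_4[of k]
  by (auto simp: det3_def algebra_simps)

lemma form_of_det3_zero:
  assumes det0: "\<And>a b. det3 a b (mult_of_table T a b) = 0"
  obtains f g h where "form_algebra f g h" "mult_of_table T = form_algebra.mul f g h"
proof -
  interpret A: complex_algebra "(*s)" "mult_of_table T" by (rule complex_algebra_mult_of_table)
  note D = det3_eq_0_permute[OF _ det0]
  note ex = mult_of_table_axis A.mult_add_left A.mult_add_right
  have e: "\<e> i $ j = (if i = j then 1 else 0)" for i j :: 4 by (simp add: axis_def)
  \<comment> \<open>The hypothesis is polarised by hand: evaluation at basis vectors and at sums of
    two of them isolates one relation after the other, the earlier ones removing the unwanted
    terms.\<close>
  have r1: "T (i, j) $ k = 0" if "distinct [i, j, k, 4]" for i j k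
    using that D[OF that, of "\<e> i" "\<e> j"] by (auto simp: ex e)
  have r2: "T (i, 4) $ k = 0" "T (4, i) $ k = 0" "T (i, i) $ k = 0" "T (4, 4) $ k = 0"
    if "distinct [i, j, k, 4]" for i j k
  proof -
    have "distinct [j, i, k, 4]" using that by auto
    note r = r1[OF that] r1[OF this]
    show a: "T (i, 4) $ k = 0" using that r D[OF that, of "\<e> i" "\<e> j + \<e> 4"] by (auto simp: ex e)
    show b: "T (4, i) $ k = 0" using that r D[OF that, of "\<e> j + \<e> 4" "\<e> i"] by (auto simp: ex e)
    show "T (i, i) $ k = 0" using that r D[OF that, of "\<e> i" "\<e> i + \<e> j"] by (auto simp: ex e)
    have "T (4, j) $ k = 0" using that r D[OF that, of "\<e> i + \<e> 4" "\<e> j"] by (auto simp: ex e)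
    then show "T (4, 4) $ k = 0"
      using that r a D[OF that, of "\<e> i + \<e> 4" "\<e> j + \<e> 4"] by (auto simp: ex e)
  qed
  \<comment> \<open>The coefficient of the right factor depends on the left factor only, and vice
    versa. These coefficients become the values of \<open>f\<close> and \<open>g\<close>.\<close>
  have r3: "T (i, k) $ k = T (i, j) $ j" "T (k, i) $ k = T (j, i) $ j"
    "T (4, k) $ k = T (4, j) $ j" "T (k, 4) $ k = T (j, 4) $ j"
    if "distinct [i, j, k, 4]" for i j k
  proof -
    have *: "distinct [j, i, k, 4]" "distinct [i, k, j, 4]" "distinct [k, i, j, 4]"
      "distinct [k, j, i, 4]" "distinct [j, k, i, 4]"
      using that by auto
    note r = r1[OF that] *[THEN r1] r2[OF that] *[THEN r2(1)] *[THEN r2(2)]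
    have ne: "i \<noteq> j" "i \<noteq> k" "j \<noteq> k" "i \<noteq> 4" "j \<noteq> 4" "k \<noteq> 4" using that by auto
    have a: "T (i, k) $ k - T (i, j) $ j = 0"
      using D[OF that, of "\<e> i" "\<e> j + \<e> k"] by (simp add: ex e r ne ne[symmetric])
    have b: "T (j, i) $ j - T (k, i) $ k = 0"
      using D[OF that, of "\<e> j + \<e> k" "\<e> i"] by (simp add: ex e r ne ne[symmetric])
    have "T (i, k) $ k - T (i, j) $ j + (T (4, k) $ k - T (4, j) $ j) = 0"
      using D[OF that, of "\<e> i + \<e> 4" "\<e> j + \<e> k"] by (simp add: ex e r ne ne[symmetric] algebra_simps)
    moreover have "T (j, i) $ j - T (k, i) $ k + (T (j, 4) $ j - T (k, 4) $ k) = 0"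
      using D[OF that, of "\<e> j + \<e> k" "\<e> i + \<e> 4"] by (simp add: ex e r ne ne[symmetric] algebra_simps)
    ultimately show "T (i, k) $ k = T (i, j) $ j" "T (k, i) $ k = T (j, i) $ j"
      "T (4, k) $ k = T (4, j) $ j" "T (k, 4) $ k = T (j, 4) $ j"
      using a b by (simp_all only: diff_zero add_0_left right_minus_eq)
  qed
  \<comment> \<open>In a square the two factors coincide, so e_i must occur with coefficient f(e_i)
    + g(e_i).\<close>
  have r4: "T (i, i) $ i = T (i, j) $ j + T (j, i) $ j" if "distinct [i, j, k, 4]" for i j k
  proof -
    have *: "distinct [j, i, k, 4]" "distinct [i, k, j, 4]" "distinct [k, i, j, 4]"
      "distinct [k, j, i, 4]" "distinct [j, k, i, 4]"
      using that by auto
    note r = r1[OF that] *[THEN r1] r2[OF that] *[THEN r2(1)] *[THEN r2(2)] *[THEN r2(3)]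
    have ne: "i \<noteq> j" "i \<noteq> k" "j \<noteq> k" "i \<noteq> 4" "j \<noteq> 4" "k \<noteq> 4" using that by auto
    have "T (i, i) $ i + T (i, k) $ i + T (j, i) $ i
        - (T (j, i) $ j + T (j, k) $ j) - (T (i, k) $ k + T (j, k) $ k) = 0"
      using D[OF that, of "\<e> i + \<e> j" "\<e> i + \<e> k"] by (simp add: ex e r ne ne[symmetric] algebra_simps)
    moreover have "T (i, k) $ k = T (i, j) $ j" "T (j, k) $ k = T (j, i) $ i"
      "T (i, k) $ i = T (j, k) $ j"
      using r3(1)[OF that] r3(1)[OF *(1)] r3(2)[OF *(4)] by simp_all
    ultimately show ?thesis by (simp add: algebra_simps)
  qed
  \<comment> \<open>f(e_i) is read off as the coefficient of e_j in e_i e_j, and g(e_i) as that of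
    e_j in e_j e_i. Any j other than i and 4 gives the same value.\<close>
  define f where "f x = x $ 1 * T (1, 2) $ 2 + x $ 2 * T (2, 1) $ 1 + x $ 3 * T (3, 1) $ 1
    + x $ 4 * T (4, 1) $ 1" for x :: "complex ^ 4"
  define g where "g x = x $ 1 * T (2, 1) $ 2 + x $ 2 * T (1, 2) $ 1 + x $ 3 * T (1, 3) $ 1
    + x $ 4 * T (1, 4) $ 1" for x :: "complex ^ 4"
  define h where "h x y = mult_of_table T x y $ 4 - f x * y $ 4 - g y * x $ 4" for x y
  have perms: "distinct [1, 2, 3, 4 :: 4]" "distinct [1, 3, 2, 4 :: 4]" "distinct [2, 1, 3, 4 :: 4]"
    "distinct [2, 3, 1, 4 :: 4]" "distinct [3, 1, 2, 4 :: 4]" "distinct [3, 2, 1, 4 :: 4]"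
    by simp_all
  note zeros = perms[THEN r1] perms[THEN r2(1)] perms[THEN r2(2)] perms[THEN r2(3)] perms[THEN r2(4)]
  have lin: "f (x + y) = f x + f y" "f (r *s x) = r * f x"
     "g (x + y) = g x + g y" "g (r *s x) = r * g x" for x y r
    by (simp_all add: f_def g_def algebra_simps)
  have mul: "mult_of_table T a b = f a *s b + g b *s a + h a b *s \<e> 4" for a b
  proof -
    have "T (1, 3) $ 3 = T (1, 2) $ 2" "T (2, 3) $ 3 = T (2, 1) $ 1" "T (3, 2) $ 2 = T (3, 1) $ 1"
      "T (4, 2) $ 2 = T (4, 1) $ 1" "T (4, 3) $ 3 = T (4, 1) $ 1"
      "T (3, 1) $ 3 = T (2, 1) $ 2" "T (3, 2) $ 3 = T (1, 2) $ 1" "T (2, 3) $ 2 = T (1, 3) $ 1"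
      "T (2, 4) $ 2 = T (1, 4) $ 1" "T (3, 4) $ 3 = T (1, 4) $ 1"
      "T (1, 1) $ 1 = T (1, 2) $ 2 + T (2, 1) $ 2" "T (2, 2) $ 2 = T (2, 1) $ 1 + T (1, 2) $ 1"
      "T (3, 3) $ 3 = T (3, 1) $ 1 + T (1, 3) $ 1"
      using r3(1)[OF perms(1)] r3(1)[OF perms(3)] r3(1)[OF perms(5)] r3(3)[OF perms(6)]
        r3(3)[OF perms(4)] r3(2)[OF perms(1)] r3(2)[OF perms(3)] r3(2)[OF perms(5)]
        r3(4)[OF perms(6)] r3(4)[OF perms(4)] r4[OF perms(1)] r4[OF perms(3)] r4[OF perms(5)]
      by simp_all
    then have "mult_of_table T a b $ l = f a * b $ l + g b * a $ l"
      if "l \<in> {1, 2, 3}" for l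
      using that zeros
      by (auto simp: mult_of_table_def sum_4 f_def g_def algebra_simps)
    then show ?thesis
      by (simp add: vec_eq_iff forall_4 h_def e)
  qed
  interpret form_algebra f g h
    by unfold_locales (simp_all add: h_def lin A.mult_add_left A.mult_add_right
        A.mult_scale_left A.mult_scale_right algebra_simps)
  show thesis
    by (rule that[OF form_algebra_axioms]) (simp add: mul mul_def fun_eq_iff)
qed

section \<open>Right alternativity\<close>

text \<open>Modulo e_4 the space has dimension 3, so its vectors y cannot all be multiples of a
  single x.\<close>

lemma eq_0_if_multiple_coordinates:
  fixes x :: "complex ^ 4"
  assumes "\<And>y i. i \<noteq> 4 \<Longrightarrow> s * y $ i = F y * x $ i"
  shows "s = 0"
  using assms[of 1 "\<e> 1"] assms[of 2 "\<e> 1"] assms[of 1 "\<e> 2"] assms[of 2 "\<e> 2"]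
  by (auto simp: axis_def)

text \<open>A group is not the union of two proper subgroups, here the kernels of \<open>f\<close>
  and \<open>g\<close>.\<close>

lemma linear_prod_eq_0:
  fixes f g :: "complex ^ 4 \<Rightarrow> complex"
  assumes f: "\<And>x y. f (x + y) = f x + f y" and g: "\<And>x y. g (x + y) = g x + g y"
    and fg: "\<And>x. f x * g x = 0"
  shows "(\<forall>x. f x = 0) \<or> (\<forall>x. g x = 0)"
proof (rule ccontr)
  assume "\<not> ?thesis"
  then obtain x y where "f x \<noteq> 0" "g y \<noteq> 0" by blast
  then show False using fg[of x] fg[of y] fg[of "x + y"] by (auto simp: f g)
qed

locale right_alternative_form = form_algebra +
  assumes right_alt: "associator mul a b b = 0"
begin

abbreviation c :: "complex ^ 4" where "c \<equiv> \<e> 4"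

definition k :: "complex ^ 4 \<Rightarrow> complex" where "k x = f x - g x"

text \<open>Modulo c, (y,b,b) = 0 makes this scalar times y a multiple of b, for every y.\<close>

lemma fg_square: "f b * g b + h b b * g c = 0"
proof (rule eq_0_if_multiple_coordinates)
  fix y :: "complex ^ 4" and i :: 4 assume "i \<noteq> 4"
  then show "(f b * g b + h b b * g c) * y $ i = (f y * g b + h y b * f c) * b $ i"
    using arg_cong[OF right_alt[of y b], of "\<lambda>v. v $ i"]
    unfolding associator_mul by (simp add: axis_def algebra_simps)
qed

text \<open>For b outside the line of c this is the coefficient of b in (a,b,b). The line itself is
  reached by linearity in b, writing c as the difference of c + e_1 and e_1.\<close>

lemma fg_polar: "f a * g b + h a b * f c = 0"
proof -
  have *: "f a * g b + h a b * f c = 0" if "i \<noteq> 4" "b $ i \<noteq> 0" for b i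
    using arg_cong[OF right_alt[of a b], of "\<lambda>v. v $ i"] that fg_square[of b]
    unfolding associator_mul by (auto simp: axis_def)
  have "f a * g (c + \<e> 1) + h a (c + \<e> 1) * f c = 0" "f a * g (\<e> 1) + h a (\<e> 1) * f c = 0"
    using *[of 1 "c + \<e> 1"] *[of 1 "\<e> 1"] by (simp_all add: axis_def del: g_add h_add_right)
  then have **: "f a * g c + h a c * f c = 0"
    unfolding g_add h_add_right by algebra
  show ?thesis
  proof (cases "\<exists>i. i \<noteq> 4 \<and> b $ i \<noteq> 0")
    case True
    then show ?thesis using * by blast
  next
    case False
    then have b: "b = b $ 4 *s c" by (auto simp: vec_eq_iff axis_def)
    have "f a * g b + h a b * f c = b $ 4 * (f a * g c + h a c * f c)"
      using g_scale[of "b $ 4" c] h_scale_right[of a "b $ 4" c]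
      unfolding b[symmetric] by (simp add: algebra_simps)
    then show ?thesis by (simp add: **)
  qed
qed

text \<open>The component of (a,b,b) = 0 along c; together with its polarisation
  \<open>h_polar\<close> it determines how h behaves at c.\<close>

lemma h_square: "h a b * (h c b - k b) = h b b * h a c"
  using arg_cong[OF right_alt[of a b], of "\<lambda>v. v $ 4"] fg_square[of b] fg_polar[of a b]
  unfolding associator_mul by (simp add: k_def algebra_simps)

definition nondegenerate :: bool where
  "nondegenerate \<longleftrightarrow>
    (\<exists>a b d. associator mul a b d + associator mul b d a + associator mul d a b \<noteq> 0)"

text \<open>If \<open>f c\<close>, \<open>g c\<close> or \<open>h c c\<close> were nonzero, \<open>h\<close> would be a product of two linear forms and all
  associators would vanish.\<close>

lemma f_c_zero:
  assumes nondegenerate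
  shows "f c = 0"
proof (rule ccontr)
  assume fc: "f c \<noteq> 0"
  have h: "h a b = - (f a * g b) / f c" for a b
    using fg_polar[of a b] fc by (simp add: field_simps add_eq_0_iff)
  have "f b * (g b * (f c - g c)) = 0" for b
    using fg_square[of b] fc by (simp add: h field_simps)
  then have "(\<forall>b. f b = 0) \<or> (\<forall>b. g b * (f c - g c) = 0)"
    by (intro linear_prod_eq_0) (simp_all add: algebra_simps)
  then have "(\<forall>b. g b = 0) \<or> f c = g c" using fc by auto
  then have "associator mul a b d = 0" for a b d
    using fc by (auto simp: associator_mul h field_simps vec_eq_iff)
  then show False using assms by (simp add: nondegenerate_def)
qed

lemma g_c_zero:
  assumes nondegenerate
  shows "g c = 0"
proof (rule ccontr)
  assume gc: "g c \<noteq> 0"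
  have "f a = 0" for a using fg_polar[of a c] f_c_zero[OF assms] gc by simp
  moreover from this have hh: "h b b = 0" for b using fg_square[of b] gc by simp
  ultimately have "h a b * (h c b + g b) = 0" for a b
    using h_square[of a b] by (simp add: k_def)
  then have "(\<forall>b. h a b = 0) \<or> (\<forall>b. h c b + g b = 0)" for a
    by (intro linear_prod_eq_0) simp_all
  then have "h a b = 0" for a b using gc hh by (metis add_0)
  then have "associator mul a b d = 0" for a b d
    using f_c_zero[OF assms] \<open>\<And>a. f a = 0\<close> by (simp add: associator_mul)
  then show False using assms by (simp add: nondegenerate_def)
qed

lemma f_or_g_zero:
  assumes nondegenerate
  shows "(\<forall>x. f x = 0) \<or> (\<forall>x. g x = 0)"
  using fg_polar f_c_zero[OF assms] by (metis add.right_neutral mult_eq_0_iff mult_zero_right)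

lemma associator_mul_nondegenerate:
  assumes nondegenerate
  shows "associator mul a b d = (h a b * h c d - h a d * k b - h b d * h a c) *s c"
  using f_c_zero[OF assms] g_c_zero[OF assms] f_or_g_zero[OF assms]
  by (auto simp: associator_mul k_def algebra_simps)

lemma k_lin [simp]: "k (x + y) = k x + k y" "k (r *s x) = r * k x"
  by (simp_all add: k_def algebra_simps)

lemma k_c_zero: "nondegenerate \<Longrightarrow> k c = 0"
  by (simp add: k_def f_c_zero g_c_zero)

lemma h_polar:
  "h a b * (h c d - k d) + h a d * (h c b - k b) = (h b d + h d b) * h a c"
  using h_square[of a "b + d"] h_square[of a b] h_square[of a d]
  by (simp add: algebra_simps)

lemma h_c_c_zero:
  assumes nd: nondegenerate
  shows "h c c = 0"
proof (rule ccontr)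
  assume r: "h c c \<noteq> 0"
  \<comment> \<open>Putting d = c in the polarised identity exhibits h as a product of two linear
    forms.\<close>
  have h1: "h a b * h c c = h a c * (h b c + k b)" for a b
    using h_polar[of a b c] k_c_zero[OF nd] by algebra
  have p: "h c b = h b c + k b" for b
    using h1[of c b] r by simp
  have "associator mul a b d = 0" for a b d
  proof -
    have "h c c * (h a b * h c d - h a d * k b - h b d * h a c) = 0"
      using h1[of a b] h1[of a d] h1[of b d] p[of d] by algebra
    then show ?thesis using r by (simp add: associator_mul_nondegenerate[OF nd])
  qed
  then show False using nd by (simp add: nondegenerate_def)
qed

text \<open>With h(c,c) = 0, the polarised identity at d = c says that the linear forms h(.,c) and
  h(.,c) + k have product zero in independent arguments, so one of them vanishes. In the second case
  h(c,.) = k follows from h being alternating.\<close>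

lemma h_left_right:
  assumes nd: nondegenerate
  shows "(\<forall>x. h c x = k x) \<and> ((\<forall>x. h x c = 0) \<or> (\<forall>x. h x c = - k x) \<and> (\<forall>x. h x x = 0))"
proof -
  have "h a c * (h b c + k b) = 0" for a b
    using h_polar[of a b c] k_c_zero[OF nd] h_c_c_zero[OF nd] by (simp add: algebra_simps)
  then consider "\<forall>x. h x c = 0" | "\<forall>x. h x c = - k x"
    by (metis eq_neg_iff_add_eq_0 mult_eq_0_iff)
  then show ?thesis
  proof cases
    case 1
    then have "h a b * (h c b - k b) = 0" for a b using h_square[of a b] by simp
    then have "(\<forall>b. h a b = 0) \<or> (\<forall>b. h c b - k b = 0)" for a
      by (intro linear_prod_eq_0) simp_all
    moreover have False if "\<And>a b. h a b = 0"
      using nd that by (simp add: nondegenerate_def associator_mul_nondegenerate[OF nd])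
    ultimately show ?thesis using 1 by auto
  next
    case 2
    then have hsq: "h a b * (h c b - k b) = - (h b b * k a)" for a b using h_square[of a b] by simp
    have hpp: "h b b * h c b = 0" for b
      using hsq[of b b] by (simp add: algebra_simps)
    \<comment> \<open>If k vanishes too, every term of the associator does. Otherwise h(a,.) is
      proportional to k(a), so h has rank at most one and the associators vanish again.\<close>
    moreover have False if p: "\<And>b. h c b = 0"
    proof -
      have "\<exists>x. k x \<noteq> 0"
      proof (rule ccontr)
        assume "\<not> ?thesis"
        then have "associator mul a b d = 0" for a b d
          using p 2 by (simp add: associator_mul_nondegenerate[OF nd])
        then show False using nd by (simp add: nondegenerate_def)
      qed
      then obtain e where e: "k e \<noteq> 0" by blast
      have hk: "h a b * k b = h b b * k a" for a b using hsq[of a b] p[of b] by simp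
      have "k b * (h a b * k e - h e b * k a) = 0" for a b
        using hk[of a b] hk[of e b] by algebra
      then have "(\<forall>b. k b = 0) \<or> (\<forall>b. h a b * k e - h e b * k a = 0)" for a
        by (intro linear_prod_eq_0) (simp_all add: algebra_simps)
      then have he: "h a b * k e = h e b * k a" for a b using e by auto
      have "associator mul a b d = 0" for a b d
      proof -
        have "k e * (h a b * h c d - h a d * k b - h b d * h a c) = 0"
          using he[of a d] he[of b d] p[of d] 2[rule_format, of a] by algebra
        then show ?thesis using e by (simp add: associator_mul_nondegenerate[OF nd])
      qed
      then show False using nd by (simp add: nondegenerate_def)
    qed
    ultimately obtain x where x: "h c x \<noteq> 0" "h x x = 0" by (metis mult_eq_0_iff)
    \<comment> \<open>The quadratic form h(b,b) times the linear form h(c,b) is zero. Where the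
      linear form vanishes, passing to b + x and b - x makes it nonzero, and adding the two results
      cancels the mixed terms.\<close>
    have alt: "h b b = 0" for b
    proof (cases "h c b = 0")
      case True
      have "h c x * (h b b + (h b x + h x b)) = 0" "h c x * (h b b - (h b x + h x b)) = 0"
        using hpp[of "b + x"] hpp[of "b - x"] x True
        unfolding h_add_left h_add_right h_diff by algebra+
      then have "h b b + (h b x + h x b) = 0" "h b b - (h b x + h x b) = 0" using x(1) by simp_all
      then show ?thesis by algebra
    qed (use hpp[of b] in simp)
    moreover have "h c b + h b c = 0" for b
      using alt[of "b + c"] unfolding h_add_left h_add_right by (simp add: alt add.commute)
    ultimately show ?thesis using 2 by (simp add: add_eq_0_iff)
  qed
qed

end

section \<open>The listed algebras\<close>

definition lin4 :: "complex ^ 4 \<Rightarrow> complex ^ 4 \<Rightarrow> complex ^ 4 \<Rightarrow> complex ^ 4 \<Rightarrow> complex ^ 4 \<Rightarrow> complex ^ 4" where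
  "lin4 e u v w x = x $ 1 *s e + x $ 2 *s u + x $ 3 *s v + x $ 4 *s w"

lemma linear_lin4: "Vector_Spaces.linear (*s) (*s) (lin4 e u v w)"
  by unfold_locales (simp_all add: lin4_def vec_eq_iff algebra_simps)

lemma bij_lin4:
  assumes "\<And>x. lin4 e u v w x = 0 \<Longrightarrow> x = 0"
  shows "bij (lin4 e u v w)"
proof -
  have "inj (lin4 e u v w)"
    using assms vec.linear_inj_iff_eq_0[OF linear_lin4] by blast
  then show ?thesis
    using vec.linear_inj_imp_surj[OF linear_lin4] by (simp add: bij_def)
qed

lemma (in bilinear_form) lin4_expand:
  "h (lin4 e u v w x) (lin4 e u v w y) =
    x $ 1 * y $ 1 * h e e + x $ 1 * y $ 2 * h e u + x $ 1 * y $ 3 * h e v + x $ 1 * y $ 4 * h e w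
    + x $ 2 * y $ 1 * h u e + x $ 2 * y $ 2 * h u u + x $ 2 * y $ 3 * h u v + x $ 2 * y $ 4 * h u w
    + x $ 3 * y $ 1 * h v e + x $ 3 * y $ 2 * h v u + x $ 3 * y $ 3 * h v v + x $ 3 * y $ 4 * h v w
    + x $ 4 * y $ 1 * h w e + x $ 4 * y $ 2 * h w u + x $ 4 * y $ 3 * h w v + x $ 4 * y $ 4 * h w w"
  by (simp add: lin4_def algebra_simps)

text \<open>Over the complex numbers an isotropic vector (p,q) exists. A form of rank 2 has a second
  isotropic line; for rank 1, (p,q) spans the radical and (m,n) can be scaled to the value -1, the
  one occurring in \<open>B01\<close>. Determinant 1 is required so that the skew part of h is
  preserved.\<close>

lemma quadratic_form_normal_basis:
  fixes s t w :: complex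
  obtains p q m n where "p * n - q * m = 1" "s * p\<^sup>2 + 2 * t * p * q + w * q\<^sup>2 = 0"
    "s * m\<^sup>2 + 2 * t * m * n + w * n\<^sup>2 = 0 \<or>
     s * m\<^sup>2 + 2 * t * m * n + w * n\<^sup>2 = - 1 \<and> s * p * m + t * (p * n + q * m) + w * q * n = 0"
proof (cases "s = 0")
  case s: True
  show thesis
  proof (cases "t = 0")
    case False
    show thesis
      by (rule that[of 1 1 0 "- w / (2 * t)"]) (use s False in \<open>auto simp: field_simps\<close>)
  next
    case t: True
    show thesis
    proof (cases "w = 0")
      case True
      show thesis by (rule that[of 1 1 0 0]) (use s t True in auto)
    next
      case False
      define z where "z = csqrt (- 1 / w)"
      have z: "w * z\<^sup>2 = - 1" using False by (simp add: z_def)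
      then have "z \<noteq> 0" by auto
      then show thesis by (intro that[of "1 / z" z 0 0]) (use s t z in auto)
    qed
  qed
next
  case s: False
  define d where "d = csqrt (t\<^sup>2 - s * w)"
  have d: "d\<^sup>2 = t\<^sup>2 - s * w" by (simp add: d_def)
  show thesis
  proof (cases "d = 0")
    case True
    \<comment> \<open>For discriminant zero the radical is spanned by (-t, s). The factor
      \<open>n\<close> gives (n, 0) the value -1 and makes the determinant 1.\<close>
    define n where "n = csqrt (- 1 / s)"
    have n: "s * n\<^sup>2 = - 1" using s by (simp add: n_def)
    have "t\<^sup>2 = s * w" using d True by simp
    then have "s * (- (t * n))\<^sup>2 + 2 * t * (- (t * n)) * (s * n) + w * (s * n)\<^sup>2 = 0" by algebra
    moreover have "- (t * n) * 0 - s * n * n = 1" using n by (simp add: power2_eq_square mult.assoc)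
    ultimately show thesis
      using n by (intro that[of "- (t * n)" 0 "s * n" n]) (simp_all add: algebra_simps)
  next
    case False
    have root: "s * x\<^sup>2 + 2 * t * x + w = 0" if "s * x = - t + d \<or> s * x = - t - d" for x
    proof -
      have "s * (s * x\<^sup>2 + 2 * t * x + w) = 0" using that d by algebra
      then show ?thesis using s by simp
    qed
    define x y where "x = (- t + d) / s" and "y = (- t - d) / s"
    have xy: "s * x = - t + d" "s * y = - t - d" using s by (simp_all add: x_def y_def)
    have "s * (x - y) = 2 * d" using xy by algebra
    then have "x - y \<noteq> 0" using False by auto
    then obtain i where "i * (x - y) = 1" using left_inverse by blast
    then have "x * i - 1 * (y * i) = 1"
      "s * (y * i)\<^sup>2 + 2 * t * (y * i) * i + w * i\<^sup>2 = 0"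
      using root[of y] xy by algebra+
    then show thesis
      using root[of x] xy by (intro that[of x i 1 "y * i"]) simp_all
  qed
qed

text \<open>Every listed product is \<open>f a b + g b a + h a b e\<^sub>4\<close> with \<open>f - g = 2 side L x\<^sub>1\<close>:
  one of \<open>f\<close>, \<open>g\<close> is \<open>2 x\<^sub>1\<close> and the other vanishes. Replacing \<open>e\<^sub>1\<close> by \<open>- e\<^sub>1\<close> in \<open>h\<close>
  exchanges the two kinds.\<close>

fun side :: "label \<Rightarrow> complex" where
  "side B01 = 1" | "side (B02 \<alpha>) = 1" | "side B03 = 1" | "side B07 = 1"
| "side B04 = - 1" | "side (B05 \<alpha>) = - 1" | "side B06 = - 1" | "side B08 = - 1"

fun label_form :: "label \<Rightarrow> complex ^ 4 \<Rightarrow> complex ^ 4 \<Rightarrow> complex" where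
  "label_form B01 x y = 2 * x $ 4 * y $ 1 + x $ 2 * y $ 3 - x $ 3 * y $ 2 - x $ 3 * y $ 3"
| "label_form (B02 \<alpha>) x y = 2 * x $ 4 * y $ 1 + (\<alpha> + 1) * x $ 2 * y $ 3 + (\<alpha> - 1) * x $ 3 * y $ 2"
| "label_form B03 x y = 2 * x $ 4 * y $ 1 + x $ 1 * y $ 2 + x $ 2 * y $ 1 + 2 * x $ 2 * y $ 3"
| "label_form B04 x y = - 2 * x $ 4 * y $ 1 + x $ 2 * y $ 3 - x $ 3 * y $ 2 - x $ 3 * y $ 3"
| "label_form (B05 \<alpha>) x y = - 2 * x $ 4 * y $ 1 + (\<alpha> + 1) * x $ 2 * y $ 3 + (\<alpha> - 1) * x $ 3 * y $ 2"
| "label_form B06 x y = - 2 * x $ 4 * y $ 1 - x $ 1 * y $ 2 - x $ 2 * y $ 1 + 2 * x $ 2 * y $ 3"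
| "label_form B07 x y = 2 * x $ 4 * y $ 1 - 2 * x $ 1 * y $ 4 + x $ 2 * y $ 3 - x $ 3 * y $ 2"
| "label_form B08 x y = - 2 * x $ 4 * y $ 1 + 2 * x $ 1 * y $ 4 + x $ 2 * y $ 3 - x $ 3 * y $ 2"

fun mirror :: "label \<Rightarrow> label" where
  "mirror B01 = B04" | "mirror (B02 \<alpha>) = B05 \<alpha>" | "mirror B03 = B06" | "mirror B07 = B08"
| "mirror B04 = B01" | "mirror (B05 \<alpha>) = B02 \<alpha>" | "mirror B06 = B03" | "mirror B08 = B07"

lemma side_mirror: "side (mirror L) = - side L"
  by (cases L) auto

lemma label_form_mirror:
  "label_form (mirror L) x y
    = label_form L (lin4 (- \<e> 1) (\<e> 2) (\<e> 3) (\<e> 4) x) (lin4 (- \<e> 1) (\<e> 2) (\<e> 3) (\<e> 4) y)"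
  by (cases L) (simp_all add: lin4_def axis_def)

interpretation label: form_algebra "\<lambda>x. (1 + side L) * x $ 1" "\<lambda>x. (1 - side L) * x $ 1" "label_form L" for L
  by unfold_locales (cases L; simp add: algebra_simps)+

lemma listed_mult_eq: "listed_mult L = label.mul L"
proof -
  have "listed_mult L x y = label.mul L x y" for x y
    unfolding listed_mult_def mult_of_table_def label.mul_def vec_eq_iff forall_4 sum_4
    by (cases L) (simp_all add: axis_def algebra_simps)
  then show ?thesis by blast
qed

lemma isomorphic_forms:
  assumes "form_algebra f g h" "form_algebra f' g' h'"
    and lin: "Vector_Spaces.linear (*s) (*s) \<theta>" and bij: "bij \<theta>"
    and f: "\<And>x. f' (\<theta> x) = f x" and g: "\<And>x. g' (\<theta> x) = g x"
    and c: "\<theta> (\<e> 4) = r *s \<e> 4" and h: "\<And>x y. h' (\<theta> x) (\<theta> y) = r * h x y"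
  shows "isomorphic_algebras (*s) (form_algebra.mul f g h) (*s) (form_algebra.mul f' g' h')"
proof -
  interpret A: form_algebra f g h by fact
  interpret B: form_algebra f' g' h' by fact
  have "\<theta> (A.mul x y) = B.mul (\<theta> x) (\<theta> y)" for x y
    unfolding A.mul_def B.mul_def vec.linear_add[OF lin] vec.linear_scale[OF lin]
    by (simp add: f g c h vec_eq_iff)
  then show ?thesis unfolding isomorphic_algebras_def using lin bij by blast
qed

section \<open>Normal forms of the bilinear form\<close>

locale kernel_form = bilinear_form h
  for k :: "complex ^ 4 \<Rightarrow> complex" and h :: "complex ^ 4 \<Rightarrow> complex ^ 4 \<Rightarrow> complex" +
  fixes c :: "complex ^ 4"
  assumes k_add [simp]: "k (x + y) = k x + k y" and k_scale [simp]: "k (r *s x) = r * k x"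
    and k_c [simp]: "k c = 0" and h_c_left [simp]: "h c x = k x"
begin

lemma k_minus [simp]: "k (- x) = - k x"
  using k_scale[of "- 1" x] by simp

lemma k_diff [simp]: "k (x - y) = k x - k y"
  using k_add[of x "- y"] by simp

lemma k_zero [simp]: "k 0 = 0"
  using k_scale[of 0 0] by simp

text \<open>The constants are those of the listed algebras with \<open>side\<close> 1: there k(e_1)
  = 2 and h(e_2,e_3) - h(e_3,e_2) = 2. The factor r appears because e_4 is to become r c.\<close>

definition skew_frame :: "complex \<Rightarrow> complex ^ 4 \<Rightarrow> complex ^ 4 \<Rightarrow> complex ^ 4 \<Rightarrow> bool" where
  "skew_frame r e u v \<longleftrightarrow> r \<noteq> 0 \<and> k e = 2 \<and> k u = 0 \<and> k v = 0 \<and> h u v - h v u = 2 * r"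

text \<open>The coordinates are recovered one by one: the first by k, the next two by the skew part
  of h against v and u, the last by h(.,e), since h(c,e) = 2.\<close>

lemma bij_skew_frame:
  assumes fr: "skew_frame r e u v" and q: "h u c = 0" "h v c = 0"
  shows "bij (lin4 e u v (r *s c))"
proof (rule bij_lin4)
  fix x assume x: "lin4 e u v (r *s c) x = 0"
  note fr' = fr[unfolded skew_frame_def]
  have 1: "x $ 1 = 0" using arg_cong[OF x, of k] fr' by (simp add: lin4_def)
  have "h (lin4 e u v (r *s c) x) v - h v (lin4 e u v (r *s c) x) = 0"
    "h u (lin4 e u v (r *s c) x) - h (lin4 e u v (r *s c) x) u = 0"
    unfolding x by simp_all
  then have "x $ 2 * (h u v - h v u) = 0" "x $ 3 * (h u v - h v u) = 0"
    using fr' 1 q by (simp_all add: lin4_def algebra_simps)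
  then have 2: "x $ 2 = 0" "x $ 3 = 0" using fr' by auto
  have "h (lin4 e u v (r *s c) x) e = 0" unfolding x by simp
  then have "x $ 4 = 0" using fr' 1 2 by (simp add: lin4_def)
  then show "x = 0" using 1 2 by (simp add: vec_eq_iff forall_4)
qed

lemma skew_frame_quadratic:
  assumes fr: "skew_frame r e u v"
  obtains u' v' where "skew_frame r e u' v'" "h u' u' = 0"
    "h v' v' = 0 \<or> h v' v' = - r \<and> h u' v' = r \<and> h v' u' = - r"
proof -
  note fr' = fr[unfolded skew_frame_def]
  define s t w where "s = h u u / r" and "t = (h u v + h v u) / (2 * r)" and "w = h v v / r"
  obtain p q m n where
    det: "p * n - q * m = 1" and
    1: "s * p\<^sup>2 + 2 * t * p * q + w * q\<^sup>2 = 0" and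
    2: "s * m\<^sup>2 + 2 * t * m * n + w * n\<^sup>2 = 0 \<or>
     s * m\<^sup>2 + 2 * t * m * n + w * n\<^sup>2 = - 1 \<and> s * p * m + t * (p * n + q * m) + w * q * n = 0"
    by (rule quadratic_form_normal_basis)
  have r: "r \<noteq> 0" using fr' by simp
  define u' v' where "u' = p *s u + q *s v" and "v' = m *s u + n *s v"
  have skew: "h u' v' - h v' u' = 2 * r"
  proof -
    have "h u' v' - h v' u' = (p * n - q * m) * (h u v - h v u)"
      by (simp add: u'_def v'_def algebra_simps)
    then show ?thesis using det fr' by simp
  qed
  have stw: "h u u = r * s" "h u v + h v u = 2 * r * t" "h v v = r * w"
    using r by (simp_all add: s_def t_def w_def)
  have uu: "h u' u' = r * (s * p\<^sup>2 + 2 * t * p * q + w * q\<^sup>2)"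
    and vv: "h v' v' = r * (s * m\<^sup>2 + 2 * t * m * n + w * n\<^sup>2)"
    and uv: "h u' v' + h v' u' = 2 * r * (s * p * m + t * (p * n + q * m) + w * q * n)"
    unfolding u'_def v'_def h_add_left h_add_right h_scale_left h_scale_right
    using stw by algebra+
  have "skew_frame r e u' v'"
    using fr' skew by (simp add: skew_frame_def u'_def v'_def)
  moreover have "h u' u' = 0" using uu 1 by simp
  moreover have "h u' v' = r \<and> h v' u' = - r" if "h u' v' + h v' u' = 0"
  proof -
    have "2 * h u' v' = 2 * r" "2 * h v' u' = - 2 * r" using that skew by algebra+
    then show ?thesis by simp
  qed
  then have "h v' v' = 0 \<or> h v' v' = - r \<and> h u' v' = r \<and> h v' u' = - r"
    using 2 vv uv by auto
  ultimately show thesis using that by blast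
qed

text \<open>Adding multiples of c affects only the values h(.,e), because h(c,.) = k vanishes on u
  and v, k(e) = 2 and h(.,c) = 0. So these values can be prescribed; \<open>m\<close> is nonzero
  only for \<open>B03\<close>.\<close>

lemma skew_frame_shift:
  assumes q: "\<And>x. h x c = 0" and fr: "skew_frame r e u v"
  obtains e' u' v' where "skew_frame r e' u' v'" "h e' e' = 0" "h u' e' = m" "h v' e' = 0"
    "h e' u' = h e u" "h e' v' = h e v" "h u' u' = h u u" "h u' v' = h u v" "h v' u' = h v u"
    "h v' v' = h v v"
proof
  define e' u' v' where "e' = e + (- h e e / 2) *s c"
    and "u' = u + ((m - h u e) / 2) *s c" and "v' = v + (- h v e / 2) *s c"
  note fr' = fr[unfolded skew_frame_def]
  show "skew_frame r e' u' v'" "h e' e' = 0" "h u' e' = m" "h v' e' = 0"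
    "h e' u' = h e u" "h e' v' = h e v" "h u' u' = h u u" "h u' v' = h u v" "h v' u' = h v u"
    "h v' v' = h v v"
    using fr' q by (simp_all add: skew_frame_def e'_def u'_def v'_def field_simps)
qed

text \<open>After u, v are normalised, e may be moved along u and v to remove h(e,.). This succeeds
  if h is nondegenerate on the span of u and v; \<alpha> = 1 and \<alpha> = -1 are the degenerate
  parameters, where \<open>B03\<close> can arise.\<close>

lemma normal_frame:
  assumes q: "\<And>x. h x c = 0" and fr: "skew_frame r e u v"
  obtains L e' u' v' where "side L = 1" "skew_frame r e' u' v'"
    "\<And>x y. h (lin4 e' u' v' (r *s c) x) (lin4 e' u' v' (r *s c) y) = r * label_form L x y"
proof -
  note main = that
  have r: "r \<noteq> 0" using fr by (simp add: skew_frame_def)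
  have finish: thesis
    if "skew_frame r e u v" "side L = 1" "h e e = 0" "h u e = r * label_form L (\<e> 2) (\<e> 1)" "h v e = 0"
      "h e u = r * label_form L (\<e> 1) (\<e> 2)" "h e v = 0" "h u u = 0"
      "h u v = r * label_form L (\<e> 2) (\<e> 3)" "h v u = r * label_form L (\<e> 3) (\<e> 2)"
      "h v v = r * label_form L (\<e> 3) (\<e> 3)" "L \<noteq> B07" for L e u v
  proof (rule main[OF that(2,1)])
    show "h (lin4 e u v (r *s c) x) (lin4 e u v (r *s c) y) = r * label_form L x y" for x y
    proof -
      have "k e = 2" "k u = 0" "k v = 0" using that(1) by (simp_all add: skew_frame_def)
      then show ?thesis
        unfolding lin4_expand h_scale_left h_scale_right h_c_left q k_c that(3-11)
        using that(2,12) by (cases L) (simp_all add: axis_def algebra_simps)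
    qed
  qed
  have shift: "skew_frame r (e + x *s u + y *s v) u v" if "skew_frame r e u v" for e u v x y
    using that by (simp add: skew_frame_def)
  \<comment> \<open>Since h(u,u) = h(v,u) = 0, moving e along u and v never changes h(e,u). If this
    value is nonzero, scaling u by \<open>a\<close> and v by its inverse turns it into r.\<close>
  have degenerate: thesis
    if fr: "skew_frame r e u v" and uu: "h u u = 0" and vv: "h v v = 0" and uv: "h u v = 2 * r"
      and vu: "h v u = 0" for e u v
  proof -
    define e1 where "e1 = e + (- h e v / h u v) *s u"
    have e1: "skew_frame r e1 u v" "h e1 v = 0"
      using fr uu uv r by (simp_all add: skew_frame_def e1_def)
    show thesis
    proof (cases "h e1 u = 0")
      case True
      obtain e' u' v' where "skew_frame r e' u' v'" "h e' e' = 0" "h u' e' = 0" "h v' e' = 0"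
        "h e' u' = h e1 u" "h e' v' = h e1 v" "h u' u' = h u u" "h u' v' = h u v" "h v' u' = h v u"
        "h v' v' = h v v"
        using skew_frame_shift[OF q e1(1), of 0] by metis
      then show thesis
        using e1 True uu uv vu vv by (intro finish[of e' u' v' "B02 1"]) (simp_all add: axis_def)
    next
      case False
      define a where "a = r / h e1 u"
      have a: "a \<noteq> 0" "a * h e1 u = r" using False r by (simp_all add: a_def)
      have fr1: "skew_frame r e1 (a *s u) (inverse a *s v)"
        using e1 a by (simp add: skew_frame_def field_simps)
      have "h e1 (a *s u) = r" "h e1 (inverse a *s v) = 0" "h (a *s u) (a *s u) = 0"
        "h (a *s u) (inverse a *s v) = 2 * r" "h (inverse a *s v) (a *s u) = 0"
        "h (inverse a *s v) (inverse a *s v) = 0"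
        using e1 a uu uv vu vv by simp_all
      then obtain e' u' v' where "skew_frame r e' u' v'" "h e' e' = 0" "h u' e' = r" "h v' e' = 0"
        "h e' u' = r" "h e' v' = 0" "h u' u' = 0" "h u' v' = 2 * r" "h v' u' = 0" "h v' v' = 0"
        using skew_frame_shift[OF q fr1, of r] by metis
      then show thesis
        by (intro finish[of e' u' v' B03]) (simp_all add: axis_def)
    qed
  qed
  obtain u v where fr: "skew_frame r e u v" and uu: "h u u = 0"
    and vv: "h v v = 0 \<or> h v v = - r \<and> h u v = r \<and> h v u = - r"
    using skew_frame_quadratic[OF fr] by blast
  define \<alpha> where "\<alpha> = h u v / r - 1"
  have uv: "h u v = r * (\<alpha> + 1)" using r by (simp add: \<alpha>_def)
  have vu: "h v u = r * (\<alpha> - 1)"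
    using fr uv by (simp add: skew_frame_def algebra_simps)
  consider "h v v = - r" "h u v = r" "h v u = - r" | "h v v = 0" "\<alpha> \<noteq> 1" "\<alpha> \<noteq> - 1" 
    | "h v v = 0" "\<alpha> = 1" | "h v v = 0" "\<alpha> = - 1"
    using vv by blast
  then show thesis
  proof cases
    case 1
    \<comment> \<open>The coefficients solve h(e1,u) = h(e1,v) = 0.\<close>
    define e1 where "e1 = e + ((h e u - h e v) / r) *s u + (h e u / r) *s v"
    have e1: "skew_frame r e1 u v" "h e1 u = 0" "h e1 v = 0"
      unfolding e1_def by (rule shift[OF fr]) (use 1 uu r in \<open>simp_all add: field_simps\<close>)
    obtain e' u' v' where "skew_frame r e' u' v'" "h e' e' = 0" "h u' e' = 0" "h v' e' = 0"
      "h e' u' = h e1 u" "h e' v' = h e1 v" "h u' u' = h u u" "h u' v' = h u v" "h v' u' = h v u"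
      "h v' v' = h v v"
      using skew_frame_shift[OF q e1(1), of 0] by metis
    then show thesis using e1 1 uu by (intro finish[of e' u' v' B01]) (simp_all add: axis_def)
  next
    case 2
    then have ne: "\<alpha> - 1 \<noteq> 0" "\<alpha> + 1 \<noteq> 0" by (simp_all add: eq_neg_iff_add_eq_0)
    define e1 where "e1 = e + (- h e v / h u v) *s u + (- h e u / h v u) *s v"
    have e1: "skew_frame r e1 u v" "h e1 u = 0" "h e1 v = 0"
      unfolding e1_def by (rule shift[OF fr]) (use 2 uu uv vu r ne in simp_all)
    obtain e' u' v' where "skew_frame r e' u' v'" "h e' e' = 0" "h u' e' = 0" "h v' e' = 0"
      "h e' u' = h e1 u" "h e' v' = h e1 v" "h u' u' = h u u" "h u' v' = h u v" "h v' u' = h v u"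
      "h v' v' = h v v"
      using skew_frame_shift[OF q e1(1), of 0] by metis
    then show thesis
      using e1 2 uu uv vu by (intro finish[of e' u' v' "B02 \<alpha>"]) (simp_all add: axis_def)
  next
    case 3
    then show thesis using degenerate[of e u v] fr uu uv vu by simp
  next
    case 4
    have "skew_frame r e v (- u)" using fr by (simp add: skew_frame_def)
    then show thesis using degenerate[of e v "- u"] 4 uu uv vu by simp
  qed
qed

text \<open>An alternating h has no symmetric part to normalise and h(u,v) = r is nonzero, so moving
  e suffices and a single normal form results.\<close>

lemma alternating_normal_frame:
  assumes q: "\<And>x. h x c = - k x" and alt: "\<And>x. h x x = 0" and fr: "skew_frame r e u v"
  obtains e' where "skew_frame r e' u v"
    "\<And>x y. h (lin4 e' u v (r *s c) x) (lin4 e' u v (r *s c) y) = r * label_form B07 x y"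
proof -
  have skew: "h y x = - h x y" for x y
  proof -
    have "h x y + h y x = 0" using alt[of "x + y"]
      unfolding h_add_left h_add_right by (simp add: alt add.commute)
    then show ?thesis by algebra
  qed
  have r: "r \<noteq> 0" and uv: "h u v = r"
    using fr skew[of u v] by (auto simp: skew_frame_def)
  define e' where "e' = e + (- h e v / r) *s u + (h e u / r) *s v"
  have fr': "skew_frame r e' u v" using fr by (simp add: skew_frame_def e'_def)
  have vu: "h v u = - r" using skew[of v u] uv by simp
  have "h e' u = 0" "h e' v = 0" using uv vu r alt by (simp_all add: e'_def)
  moreover from this have "h u e' = 0" "h v e' = 0"
    using skew[of u e'] skew[of v e'] by simp_all
  moreover have "k e' = 2" "k u = 0" "k v = 0" using fr' by (simp_all add: skew_frame_def)
  ultimately have "h (lin4 e' u v (r *s c) x) (lin4 e' u v (r *s c) y) = r * label_form B07 x y" for x y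
    unfolding lin4_expand h_scale_left h_scale_right h_c_left q k_c alt
    by (simp add: uv vu algebra_simps)
  then show thesis using that fr' by blast
qed

end

section \<open>Existence of the isomorphism\<close>

definition cyclic_associator :: "('a \<Rightarrow> 'a \<Rightarrow> 'a) \<Rightarrow> 'a \<Rightarrow> 'a \<Rightarrow> 'a \<Rightarrow> 'a::ab_group_add" where
  "cyclic_associator mult x y z =
    associator mult x y z + associator mult y z x + associator mult z x y"

text \<open>The consequences of being a binary \<open>(-1,1)\<close>-algebra, but not a \<open>(-1,1)\<close>-algebra, that the
  classification needs.\<close>

definition binary_not_minus_one_one :: "('a \<Rightarrow> 'a \<Rightarrow> 'a::ab_group_add) \<Rightarrow> bool" where
  "binary_not_minus_one_one mult \<longleftrightarrow> (\<forall>x y. associator mult x y y = 0) \<and>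
    (\<forall>x y. cyclic_associator mult x y (mult x y) = 0) \<and> (\<exists>x y z. cyclic_associator mult x y z \<noteq> 0)"

lemma (in right_alternative_form) nondegenerate_iff:
  "nondegenerate \<longleftrightarrow> (\<exists>x y z. cyclic_associator mul x y z \<noteq> 0)"
  by (simp add: nondegenerate_def cyclic_associator_def)

lemma (in complex_algebra) associator_add:
  "associator mult (x + y) z w = associator mult x z w + associator mult y z w"
  "associator mult z (x + y) w = associator mult z x w + associator mult z y w"
  "associator mult z w (x + y) = associator mult z w x + associator mult z w y"
  by (simp_all add: associator_def mult_add_left mult_add_right)

lemma (in complex_algebra) associator_scale:
  "associator mult (scl r x) z w = scl r (associator mult x z w)"
  "associator mult z (scl r x) w = scl r (associator mult z x w)"
  "associator mult z w (scl r x) = scl r (associator mult z w x)"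
  by (simp_all add: associator_def mult_scale_left mult_scale_right scale_right_diff_distrib)

text \<open>Right alternativity follows for the whole algebra by polarising (x,y,y) = 0, so it is
  the cyclic identity that must fail.\<close>

lemma (in complex_algebra) binary_not_minus_one_one:
  assumes bin: "binary_minus_one_one scl mult" and not: "\<not> minus_one_one_on UNIV mult"
  shows "binary_not_minus_one_one mult"
proof -
  have gen: "x \<in> generated_subalgebra scl mult {x, y}" "y \<in> generated_subalgebra scl mult {x, y}"
    "mult x y \<in> generated_subalgebra scl mult {x, y}" for x y
    by (auto simp: generated_subalgebra_def is_subalgebra_def)
  note bin' = bin[unfolded binary_minus_one_one_def minus_one_one_on_def right_alternative_on_def, rule_format]
  have alt: "associator mult x y y = 0" for x y
  proof -
    have "associator mult x y y = - associator mult x y y"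
      using bin' gen by blast
    then have "scl 2 (associator mult x y y) = 0"
      using scale_left_distrib[of 1 1 "associator mult x y y"] by (simp add: eq_neg_iff_add_eq_0)
    then show ?thesis by simp
  qed
  have "cyclic_associator mult x y (mult x y) = 0" for x y
    unfolding cyclic_associator_def using bin' gen by blast
  moreover have "associator mult x y z = - associator mult x z y" for x y z
    using alt[of x "y + z"] unfolding associator_add
    by (simp add: alt eq_neg_iff_add_eq_0 add.commute)
  then have "\<exists>x y z. cyclic_associator mult x y z \<noteq> 0"
    using not unfolding minus_one_one_on_def right_alternative_on_def cyclic_associator_def by blast
  ultimately show ?thesis using alt by (simp add: binary_not_minus_one_one_def)
qed

lemma binary_not_minus_one_one_isomorphic:
  assumes "complex_algebra scl1 mult1" "complex_algebra scl2 mult2"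
    and "isomorphic_algebras scl1 mult1 scl2 mult2" and good: "binary_not_minus_one_one mult1"
  shows "binary_not_minus_one_one mult2"
proof -
  interpret A: complex_algebra scl1 mult1 by fact
  interpret B: complex_algebra scl2 mult2 by fact
  interpret vector_space_pair scl1 scl2 by unfold_locales
  obtain f where f: "Vector_Spaces.linear scl1 scl2 f" "bij f"
    "\<And>x y. f (mult1 x y) = mult2 (f x) (f y)"
    using assms(3) unfolding isomorphic_algebras_def by blast
  have assoc: "associator mult2 (f x) (f y) (f z) = f (associator mult1 x y z)" for x y z
    by (simp add: associator_def f(3)[symmetric] linear_diff[OF f(1)])
  then have cyc: "cyclic_associator mult2 (f x) (f y) (f z) = f (cyclic_associator mult1 x y z)" for x y z
    by (simp add: cyclic_associator_def linear_add[OF f(1)])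
  have f0: "f x = 0 \<longleftrightarrow> x = 0" for x
    using f(2) linear_0[OF f(1)] by (metis bij_is_inj injD)
  have surj: "\<exists>x. y = f x" for y using f(2) by (metis bij_pointE)
  show ?thesis
    unfolding binary_not_minus_one_one_def
  proof (intro conjI allI)
    fix x y
    obtain a b where "x = f a" "y = f b" using surj by metis
    then show "associator mult2 x y y = 0" "cyclic_associator mult2 x y (mult2 x y) = 0"
      using good by (simp_all add: assoc cyc f0 f(3)[symmetric] binary_not_minus_one_one_def)
  qed (use good cyc f0 in \<open>metis binary_not_minus_one_one_def\<close>)
qed

section \<open>A basis adapted to the kernel of the alternating 3-form\<close>

definition frame :: "'a \<Rightarrow> 'a \<Rightarrow> 'a \<Rightarrow> 'a \<Rightarrow> 4 \<Rightarrow> 'a" where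
  "frame a b c d = (\<lambda>_. d)(1 := a, 2 := b, 3 := c)"

lemma basis_map_frame: "basis_map (*s) (frame x y z w) = lin4 x y z w"
  by (simp add: fun_eq_iff basis_map_def frame_def lin4_def sum_4)

lemma exists_det3_table:
  assumes good: "binary_not_minus_one_one (mult_of_table T)"
  obtains T' where "isomorphic_algebras (*s) (mult_of_table T) (*s) (mult_of_table T')"
    "\<And>a b. det3 a b (mult_of_table T' a b) = 0"
proof -
  interpret A: complex_algebra "(*s)" "mult_of_table T" by (rule complex_algebra_mult_of_table)
  obtain x y z where "cyclic_associator (mult_of_table T) x y z \<noteq> 0"
    using good by (auto simp: binary_not_minus_one_one_def)
  then obtain i where i: "cyclic_associator (mult_of_table T) x y z $ i \<noteq> 0"
    by (auto simp: vec_eq_iff)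
  \<comment> \<open>A nonzero alternating 3-form on a 4-dimensional space has a 1-dimensional kernel, spanned
    by \<open>c\<close> below; it is a multiple of \<open>det3\<close> in any basis ending with \<open>c\<close>.\<close>
  define w where "w a b d = cyclic_associator (mult_of_table T) a b d $ i" for a b d
  have add: "w (a + a') b d = w a b d + w a' b d" "w b (a + a') d = w b a d + w b a' d"
    "w b d (a + a') = w b d a + w b d a'" for a a' b d
    by (simp_all add: w_def cyclic_associator_def A.associator_add)
  have scale: "w (r *s a) b d = r * w a b d" "w b (r *s a) d = r * w b a d" 
    "w b d (r *s a) = r * w b d a" for a b d r
    by (simp_all add: w_def cyclic_associator_def A.associator_scale algebra_simps)
  have assoc: "associator (mult_of_table T) a b b = 0" for a b
    using good by (simp add: binary_not_minus_one_one_def)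
  have w0: "w a b b = 0" for a b
  proof -
    have "associator (mult_of_table T) b b a + associator (mult_of_table T) b a b = 0"
      using assoc[of b "a + b"] unfolding A.associator_add by (simp add: assoc)
    then show ?thesis
      by (simp add: w_def cyclic_associator_def assoc flip: vector_add_component)
  qed
  have cyc: "w a b d = w b d a" for a b d
    by (simp add: w_def cyclic_associator_def algebra_simps)
  have w0': "w b a b = 0" "w b b a = 0" for a b using w0 cyc by metis+
  have swap: "w b a d = - w a b d" for a b d
    using w0'(2)[of "a + b" d] unfolding add by (simp add: w0' eq_neg_iff_add_eq_0 add.commute)
  have mul0: "w a b (mult_of_table T a b) = 0" for a b
    using good by (simp add: w_def binary_not_minus_one_one_def)
  \<comment> \<open>The three conditions define an endomorphism \<open>N\<close> whose image misses
    e_4; hence it is not injective.\<close>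
  obtain c where c: "c \<noteq> 0" "w y z c = 0" "w z x c = 0" "w x y c = 0"
  proof -
    define N where "N v = w y z v *s \<e> 1 + w z x v *s \<e> 2 + w x y v *s \<e> 3" for v
    have lin: "Vector_Spaces.linear (*s) (*s) N"
      by unfold_locales (simp_all add: N_def add scale vec_eq_iff algebra_simps)
    have "\<e> 4 \<noteq> N v" for v by (simp add: N_def vec_eq_iff forall_4 axis_def)
    then have "\<not> surj N" by (metis surj_def)
    then have "\<not> inj N" using vec.linear_inj_imp_surj[OF lin] by blast
    then obtain c where "c \<noteq> 0" "N c = 0" using vec.linear_inj_iff_eq_0[OF lin] by blast
    then show thesis by (intro that[of c]) (simp_all add: N_def vec_eq_iff forall_4 axis_def)
  qed
  define D where "D = w x y z"
  have D: "D \<noteq> 0" using i by (simp add: D_def w_def)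
  have vals: "w x y z = D" "w y z x = D" "w z x y = D" "w y x z = - D" "w x z y = - D" "w z y x = - D"
    "w x y c = 0" "w y x c = 0" "w y z c = 0" "w z y c = 0" "w x z c = 0" "w z x c = 0"
    "w x c y = 0" "w y c x = 0" "w y c z = 0" "w z c y = 0" "w x c z = 0" "w z c x = 0"
    "w c x y = 0" "w c y x = 0" "w c y z = 0" "w c z y = 0" "w c x z = 0" "w c z x = 0"
    using c D_def cyc swap by (metis neg_equal_0_iff_equal)+
  let ?\<theta> = "lin4 x y z c"
  have vol: "w (?\<theta> a) (?\<theta> b) (?\<theta> d) = D * det3 a b d" for a b d
    unfolding lin4_def add scale vals w0 w0' det3_def by (simp add: algebra_simps)
  have coord: "w y z (?\<theta> t) = t $ 1 * D" "w z x (?\<theta> t) = t $ 2 * D" "w x y (?\<theta> t) = t $ 3 * D" for t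
    unfolding lin4_def add scale vals w0 w0' by simp_all
  have bij: "bij ?\<theta>"
  proof (rule bij_lin4)
    fix t assume t: "?\<theta> t = 0"
    have "w a b 0 = 0" for a b using scale(3)[of a b 0 0] by simp
    then have "t $ 1 = 0" "t $ 2 = 0" "t $ 3 = 0" using coord[of t] D unfolding t by simp_all
    moreover from this have "t $ 4 = 0" using t c(1) by (simp add: lin4_def)
    ultimately show "t = 0" by (simp add: vec_eq_iff forall_4)
  qed
  obtain T' where hom: "\<And>a b. ?\<theta> (mult_of_table T' a b) = mult_of_table T (?\<theta> a) (?\<theta> b)"
    and iso: "isomorphic_algebras (*s) (mult_of_table T) (*s) (mult_of_table T')"
    using A.exists_table[of "frame x y z c"] bij unfolding basis_map_frame by metis
  have "D * det3 a b (mult_of_table T' a b) = 0" for a b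
    unfolding vol[symmetric] hom by (rule mul0)
  then show thesis using that iso D by simp
qed

lemma right_alternative_form_label:
  assumes "right_alternative_form f g h" and "right_alternative_form.nondegenerate f g h"
  obtains L where "isomorphic_algebras (*s) (listed_mult L) (*s) (form_algebra.mul f g h)"
proof -
  interpret right_alternative_form f g h by fact
  note nd = assms(2)
  have kf: "kernel_form k h c"
    using h_left_right[OF nd] k_c_zero[OF nd] by unfold_locales simp_all
  interpret K: kernel_form k h c by fact
  \<comment> \<open>\<open>Z\<close> is the wedge product of k with the skew part of h.\<close>
  define Z where "Z a b d = k d * (h a b - h b a) + k a * (h b d - h d b) + k b * (h d a - h a d)" for a b d
  obtain a b d where "Z a b d \<noteq> 0"
  proof -
    obtain a b d where abd:
      "associator mul a b d + associator mul b d a + associator mul d a b \<noteq> 0"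
      using nd unfolding nondegenerate_def by blast
    have q: "(\<forall>x. h x c = 0) \<or> (\<forall>x. h x c = - k x) \<and> (\<forall>x. h x x = 0)"
      using h_left_right[OF nd] by blast
    have "associator mul a b d + associator mul b d a + associator mul d a b = (3 * Z a b d / 2) *s c"
      if q: "\<And>x. h x c = - k x" and alt: "\<And>x. h x x = 0"
    proof -
      have "h y x = - h x y" for x y
      proof -
        have "h x y + h y x = 0"
          using alt[of "x + y"] unfolding h_add_left h_add_right by (simp add: alt add.commute)
        then show ?thesis by algebra
      qed
      from this[of a b] this[of b d] this[of a d] show ?thesis
        unfolding associator_mul_nondegenerate[OF nd]
        by (simp add: Z_def q vec_eq_iff algebra_simps)
    qed
    moreover have "associator mul a b d + associator mul b d a + associator mul d a b = Z a b d *s c"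
      if q: "\<And>x. h x c = 0"
      unfolding associator_mul_nondegenerate[OF nd]
      by (simp add: Z_def q vec_eq_iff algebra_simps)
    ultimately have "Z a b d \<noteq> 0" using abd q by auto
    then show thesis by (rule that)
  qed
  then obtain a b d where Z: "Z a b d \<noteq> 0" and kd: "k d \<noteq> 0"
  proof -
    assume "Z a b d \<noteq> 0"
    moreover from this have "k a \<noteq> 0 \<or> k b \<noteq> 0 \<or> k d \<noteq> 0" by (auto simp: Z_def)
    moreover have "Z a b d = Z b d a" "Z a b d = Z d a b" by (simp_all add: Z_def)
    ultimately show thesis using that by metis
  qed
  \<comment> \<open>Projection to ker k along d leaves the alternating \<open>Z a b d\<close>
    unchanged and reduces it to its first term.\<close>
  define u v where "u = a - (k a / k d) *s d" and "v = b - (k b / k d) *s d"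
  have "k d * (h u v - h v u) = Z a b d"
    using kd by (simp add: u_def v_def Z_def field_simps)
  moreover have "k u = 0" "k v = 0" using kd by (simp_all add: u_def v_def)
  ultimately have "K.skew_frame ((h u v - h v u) / 2) ((2 / k d) *s d) u v"
    using kd Z by (auto simp: K.skew_frame_def)
  then obtain r e u v where fr: "K.skew_frame r e u v" by blast
  obtain L e u v where L: "side L = 1" and fr: "K.skew_frame r e u v"
    and gram: "\<And>x y. h (lin4 e u v (r *s c) x) (lin4 e u v (r *s c) y) = r * label_form L x y"
  proof -
    from h_left_right[OF nd] consider "\<And>x. h x c = 0" | "\<And>x. h x c = - k x" "\<And>x. h x x = 0" by blast
    then show thesis
    proof cases
      case 1
      show thesis by (rule K.normal_frame[OF 1 fr]) (rule that)
    next
      case 2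
      show thesis by (rule K.alternating_normal_frame[OF 2 fr]) (rule that[of B07], simp_all)
    qed
  qed
  let ?\<theta> = "lin4 e u v (r *s c)"
  have kuv: "k e = 2" "k u = 0" "k v = 0" using fr by (auto simp: K.skew_frame_def)
  have "h x c = 0 \<or> h x c = - k x" for x using h_left_right[OF nd] by blast
  then have bij: "bij ?\<theta>" using kuv by (intro K.bij_skew_frame[OF fr]) fastforce+
  have k\<theta>: "k (?\<theta> x) = 2 * x $ 1" for x
    using kuv k_c_zero[OF nd] by (simp add: lin4_def)
  have \<theta>c: "lin4 e' u v (r *s c) c = r *s c" for e' by (simp add: lin4_def axis_def)
  from f_or_g_zero[OF nd] show thesis
  proof
    assume g: "\<forall>x. g x = 0"
    have "isomorphic_algebras (*s) (listed_mult L) (*s) mul"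
      unfolding listed_mult_eq
      by (rule isomorphic_forms[OF label.form_algebra_axioms form_algebra_axioms linear_lin4 bij _ _ \<theta>c gram])
        (use k\<theta> g L in \<open>simp_all add: k_def\<close>)
    then show thesis by (rule that)
  next
    assume f: "\<forall>x. f x = 0"
    \<comment> \<open>Now k = - g, so k(e) = 2 means g(e) = -2. Negating e corrects the sign and
      leads to the mirrored label.\<close>
    let ?\<sigma> = "lin4 (- \<e> 1) (\<e> 2) (\<e> 3) (\<e> 4)"
    have comp: "lin4 (- e) u v (r *s c) x = ?\<theta> (?\<sigma> x)" for x
      by (simp add: lin4_def axis_def)
    have "bij ?\<sigma>"
      by (rule bij_lin4) (simp add: lin4_def vec_eq_iff forall_4 axis_def)
    then have bij': "bij (lin4 (- e) u v (r *s c))"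
      using bij_comp[OF _ bij, of ?\<sigma>] by (simp add: comp[abs_def] comp_def)
    have \<sigma>1: "?\<sigma> x $ 1 = - x $ 1" for x by (simp add: lin4_def axis_def)
    have g\<theta>: "g (?\<theta> x) = - (2 * x $ 1)" for x using k\<theta>[of x] f by (simp add: k_def minus_equation_iff)
    have "isomorphic_algebras (*s) (listed_mult (mirror L)) (*s) mul"
      unfolding listed_mult_eq
      by (rule isomorphic_forms[OF label.form_algebra_axioms form_algebra_axioms linear_lin4 bij' _ _ \<theta>c])
        (use g\<theta> f L in \<open>simp_all add: comp side_mirror label_form_mirror gram \<sigma>1\<close>)
    then show thesis by (rule that)
  qed
qed

lemma (in complex_algebra) exists_label:
  assumes "dim UNIV = 4" "binary_minus_one_one scl mult" "\<not> minus_one_one_on UNIV mult"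
  shows "\<exists>L. isomorphic_algebras scl mult (*s) (listed_mult L)"
proof -
  obtain b where "bij (basis_map scl b)" using bij_basis_map_of_dim[OF assms(1)] .
  then obtain T0 where iso0: "isomorphic_algebras scl mult (*s) (mult_of_table T0)"
    using exists_table by metis
  have "binary_not_minus_one_one (mult_of_table T0)"
    by (rule binary_not_minus_one_one_isomorphic[OF complex_algebra_axioms
          complex_algebra_mult_of_table iso0 binary_not_minus_one_one[OF assms(2,3)]])
  then obtain T where iso: "isomorphic_algebras (*s) (mult_of_table T0) (*s) (mult_of_table T)"
    and good: "binary_not_minus_one_one (mult_of_table T)"
    and det: "\<And>a b. det3 a b (mult_of_table T a b) = 0"
    using exists_det3_table complex_algebra_mult_of_table binary_not_minus_one_one_isomorphic by metis
  obtain f g h where "form_algebra f g h" and T: "mult_of_table T = form_algebra.mul f g h"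
    using form_of_det3_zero[OF det] .
  then interpret form_algebra f g h by simp
  interpret right_alternative_form f g h
    using good unfolding T by unfold_locales (simp add: binary_not_minus_one_one_def)
  have "nondegenerate"
    using good unfolding T by (simp add: binary_not_minus_one_one_def nondegenerate_iff)
  then obtain L where "isomorphic_algebras (*s) (listed_mult L) (*s) (mult_of_table T)"
    unfolding T using right_alternative_form_label[OF right_alternative_form_axioms] by blast
  then have "isomorphic_algebras (*s) (mult_of_table T) (*s) (listed_mult L)"
    unfolding listed_mult_def
    by (rule isomorphic_algebras_sym[OF complex_algebra_mult_of_table complex_algebra_mult_of_table])
  then show ?thesis using iso0 iso isomorphic_algebras_trans by blast
qed

section \<open>Pairwise non-isomorphism\<close>

lemma side_cases: "side L = 1 \<or> side L = - 1"
  by (cases L) auto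

definition form_iso :: "label \<Rightarrow> label \<Rightarrow> complex \<Rightarrow> (complex ^ 4 \<Rightarrow> complex ^ 4) \<Rightarrow> bool" where
  "form_iso L L' r \<theta> \<longleftrightarrow> r \<noteq> 0 \<and> \<theta> (\<e> 4) = r *s \<e> 4 \<and> (\<forall>x. \<theta> x $ 1 = x $ 1) \<and>
    (\<forall>x y. label_form L' (\<theta> x) (\<theta> y) = r * label_form L x y)"

lemma form_iso_mirror:
  assumes "form_iso L L' r \<theta>"
  shows "\<exists>\<theta>'. form_iso (mirror L) (mirror L') r \<theta>'"
proof -
  let ?\<sigma> = "lin4 (- \<e> 1) (\<e> 2) (\<e> 3) (\<e> 4)"
  have \<sigma>\<sigma>: "?\<sigma> (?\<sigma> x) = x" and \<sigma>4: "?\<sigma> (a *s \<e> 4) = a *s \<e> 4" and \<sigma>1: "?\<sigma> x $ 1 = - x $ 1" for x a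
    by (simp_all add: lin4_def vec_eq_iff forall_4 axis_def)
  have "?\<sigma> (\<e> 4) = \<e> 4" using \<sigma>4[of 1] by simp
  then have "form_iso (mirror L) (mirror L') r (\<lambda>x. ?\<sigma> (\<theta> (?\<sigma> x)))"
    using assms by (simp add: form_iso_def label_form_mirror \<sigma>\<sigma> \<sigma>4 \<sigma>1)
  then show ?thesis by blast
qed

lemma associator_label:
  "associator (label.mul L) x y z = (label_form L x y * label_form L (\<e> 4) z
    - 2 * side L * y $ 1 * label_form L x z - label_form L y z * label_form L x (\<e> 4)) *s \<e> 4"
  unfolding label.associator_mul by (cases L) (simp_all add: vec_eq_iff axis_def algebra_simps)

text \<open>Shows that an isomorphism must preserve the line of e_4, as all associators lie on it.
  The constant is k(e_1) (h(e_2,e_3) - h(e_3,e_2)) = 4 \<open>side L\<close>, times 3/2 for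
  \<open>B07\<close> and \<open>B08\<close>.\<close>

lemma associator_label_frame:
  obtains s where "s \<noteq> 0"
    "associator (label.mul L) (\<e> 1) (\<e> 2) (\<e> 3) + associator (label.mul L) (\<e> 2) (\<e> 3) (\<e> 1)
      + associator (label.mul L) (\<e> 3) (\<e> 1) (\<e> 2) = s *s \<e> 4"
proof
  show "(if L = B07 \<or> L = B08 then 6 * side L else 4 * side L) \<noteq> 0" using side_cases[of L] by auto
  show "associator (label.mul L) (\<e> 1) (\<e> 2) (\<e> 3) + associator (label.mul L) (\<e> 2) (\<e> 3) (\<e> 1)
      + associator (label.mul L) (\<e> 3) (\<e> 1) (\<e> 2) = (if L = B07 \<or> L = B08 then 6 * side L else 4 * side L) *s \<e> 4"
    unfolding associator_label by (cases L) (simp_all add: vec_eq_iff axis_def)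
qed

lemma isomorphic_labels_form_iso:
  assumes "isomorphic_algebras (*s) (listed_mult L) (*s) (listed_mult L')"
  obtains r \<theta> where "side L = side L'" "form_iso L L' r \<theta>"
proof -
  obtain \<theta> where lin: "Vector_Spaces.linear (*s) (*s) \<theta>" and bij: "bij \<theta>"
    and hom: "\<And>x y. \<theta> (label.mul L x y) = label.mul L' (\<theta> x) (\<theta> y)"
    using assms unfolding isomorphic_algebras_def listed_mult_eq by blast
  have assoc: "\<theta> (associator (label.mul L) x y z) = associator (label.mul L') (\<theta> x) (\<theta> y) (\<theta> z)" for x y z
    by (simp add: associator_def hom vec.linear_diff[OF lin])
  obtain s where s: "s \<noteq> 0"
    "associator (label.mul L) (\<e> 1) (\<e> 2) (\<e> 3) + associator (label.mul L) (\<e> 2) (\<e> 3) (\<e> 1)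
      + associator (label.mul L) (\<e> 3) (\<e> 1) (\<e> 2) = s *s \<e> 4"
    by (rule associator_label_frame)
  have "s *s \<theta> (\<e> 4) = associator (label.mul L') (\<theta> (\<e> 1)) (\<theta> (\<e> 2)) (\<theta> (\<e> 3))
      + associator (label.mul L') (\<theta> (\<e> 2)) (\<theta> (\<e> 3)) (\<theta> (\<e> 1))
      + associator (label.mul L') (\<theta> (\<e> 3)) (\<theta> (\<e> 1)) (\<theta> (\<e> 2))"
    unfolding assoc[symmetric] vec.linear_add[OF lin, symmetric] s(2) vec.linear_scale[OF lin] ..
  then obtain t where "s *s \<theta> (\<e> 4) = t *s \<e> 4"
    unfolding associator_label vector_sadd_rdistrib[symmetric] by blast
  then have \<theta>4: "\<theta> (\<e> 4) = (t / s) *s \<e> 4"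
    using s(1) by (simp add: vec_eq_iff field_simps)
  define r where "r = t / s"
  have "\<theta> (\<e> 4) \<noteq> 0"
    using bij vec.linear_inj_iff_eq_0[OF lin] by (auto simp: bij_def axis_eq_0_iff)
  then have r: "r \<noteq> 0" using \<theta>4 by (auto simp: r_def)
  have eq: "((1 + side L) * x $ 1 - (1 + side L') * \<theta> x $ 1) * \<theta> y $ i
      + ((1 - side L) * y $ 1 - (1 - side L') * \<theta> y $ 1) * \<theta> x $ i
      + (r * label_form L x y - label_form L' (\<theta> x) (\<theta> y)) * \<e> 4 $ i = 0" for x y i
    using arg_cong[OF hom[of x y], of "\<lambda>v. v $ i"]
    unfolding label.mul_def vec.linear_add[OF lin] vec.linear_scale[OF lin] \<theta>4 r_def[symmetric]
    by (simp add: algebra_simps)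
  have surj: "\<theta> (inv \<theta> y) = y" for y using bij by (simp add: bij_is_surj surj_f_inv_f)
  \<comment> \<open>Modulo e_4, with y in place of \<theta> y: a scalar depending on x alone times y
    is a multiple of \<theta> x for all y, so the scalar is 0. The second identity comes from the
    exchanged product.\<close>
  have eq0: "((1 + side L) * x $ 1 - (1 + side L') * \<theta> x $ 1) * y $ i
      + ((1 - side L) * inv \<theta> y $ 1 - (1 - side L') * y $ 1) * \<theta> x $ i = 0"
    "((1 - side L) * x $ 1 - (1 - side L') * \<theta> x $ 1) * y $ i
      + ((1 + side L) * inv \<theta> y $ 1 - (1 + side L') * y $ 1) * \<theta> x $ i = 0"
    if "i \<noteq> 4" for x y i
  proof -
    have "\<e> 4 $ i = 0" using that by (simp add: axis_def)
    then show "((1 + side L) * x $ 1 - (1 + side L') * \<theta> x $ 1) * y $ i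
      + ((1 - side L) * inv \<theta> y $ 1 - (1 - side L') * y $ 1) * \<theta> x $ i = 0"
      "((1 - side L) * x $ 1 - (1 - side L') * \<theta> x $ 1) * y $ i
      + ((1 + side L) * inv \<theta> y $ 1 - (1 + side L') * y $ 1) * \<theta> x $ i = 0"
      using eq[of x "inv \<theta> y" i] eq[of "inv \<theta> y" x i] unfolding surj by algebra+
  qed
  have fx: "(1 + side L) * x $ 1 - (1 + side L') * \<theta> x $ 1 = 0" for x
    by (rule eq_0_if_multiple_coordinates[where x = "\<theta> x"
          and F = "\<lambda>y. - ((1 - side L) * inv \<theta> y $ 1 - (1 - side L') * y $ 1)"])
      (unfold mult_minus_left, rule eq_neg_iff_add_eq_0[THEN iffD2], rule eq0(1))
  have gx: "(1 - side L) * x $ 1 - (1 - side L') * \<theta> x $ 1 = 0" for x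
    by (rule eq_0_if_multiple_coordinates[where x = "\<theta> x"
          and F = "\<lambda>y. - ((1 + side L) * inv \<theta> y $ 1 - (1 + side L') * y $ 1)"])
      (unfold mult_minus_left, rule eq_neg_iff_add_eq_0[THEN iffD2], rule eq0(2))
  have side: "side L = side L'"
    using fx[of "\<e> 1"] gx[of "\<e> 1"] side_cases[of L] side_cases[of L'] by (auto simp: axis_def)
  have "\<theta> x $ 1 = x $ 1" for x
    using fx[of x] gx[of x] side side_cases[of L] by auto
  moreover have "label_form L' (\<theta> x) (\<theta> y) = r * label_form L x y" for x y
    using eq[of x y 4] fx[of x] gx[of y] by (simp add: axis_def)
  ultimately have "form_iso L L' r \<theta>" using r \<theta>4 by (simp add: form_iso_def r_def)
  with side show thesis by (rule that)
qed

lemma form_iso_left_labels: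
  assumes iso: "form_iso L L' r \<theta>" and side: "side L = 1" "side L' = 1"
  shows "L = L' \<or> (\<exists>\<alpha>. L = B02 \<alpha> \<and> L' = B02 (- \<alpha>))"
proof -
  define e u v where "e = \<theta> (\<e> 1)" and "u = \<theta> (\<e> 2)" and "v = \<theta> (\<e> 3)"
  have r: "r \<noteq> 0" and c: "\<theta> (\<e> 4) = r *s \<e> 4" and 1: "e $ 1 = 1" "u $ 1 = 0" "v $ 1 = 0"
    and form: "label_form L' (\<theta> x) (\<theta> y) = r * label_form L x y" for x y
    using iso by (simp_all add: form_iso_def e_def u_def v_def axis_def)
  have ec: "r * label_form L' e (\<e> 4) = r * label_form L (\<e> 1) (\<e> 4)"
    using form[of "\<e> 1" "\<e> 4"] by (simp add: c e_def)
  note uu = form[of "\<e> 2" "\<e> 2", folded u_def v_def]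
    and uv = form[of "\<e> 2" "\<e> 3", folded u_def v_def]
    and vu = form[of "\<e> 3" "\<e> 2", folded u_def v_def]
    and vv = form[of "\<e> 3" "\<e> 3", folded u_def v_def]
    and eu = form[of "\<e> 1" "\<e> 2", folded e_def u_def]
    and ev = form[of "\<e> 1" "\<e> 3", folded e_def v_def]
  have "L = B07 \<longleftrightarrow> L' = B07"
    using ec r side 1 by (cases L; cases L') (simp_all add: axis_def)
  moreover have ?thesis if L: "L \<noteq> B07" "L' \<noteq> B07"
  proof -
    have "2 * (u $ 2 * v $ 3 - u $ 3 * v $ 2) = 2 * r"
      using arg_cong2[OF uv vu, of minus] side 1 L
      by (cases L; cases L') (simp_all add: axis_def algebra_simps)
    then have \<delta>: "u $ 2 * v $ 3 - u $ 3 * v $ 2 = r" by algebra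
    \<comment> \<open>\<open>d\<close> is 1 for \<open>B01\<close>, 1 - \<alpha>^2 for
      \<open>B02 \<alpha>\<close> and 0 for \<open>B03\<close>. It leaves open \<open>B01\<close>
      against \<open>B02 0\<close>, told apart by h(x,x), and \<open>B03\<close> against
      \<open>B02\<close> with \<alpha> = 1 or -1, told apart by h(e,.).\<close>
    define d where "d L = label_form L (\<e> 2) (\<e> 2) * label_form L (\<e> 3) (\<e> 3)
      - label_form L (\<e> 2) (\<e> 3) * label_form L (\<e> 3) (\<e> 2)" for L
    have "label_form L' u u * label_form L' v v - label_form L' u v * label_form L' v u
      = d L' * (u $ 2 * v $ 3 - u $ 3 * v $ 2)\<^sup>2"
      using side 1 L by (cases L') (simp_all add: d_def axis_def power2_eq_square algebra_simps)
    then have "r\<^sup>2 * d L = r\<^sup>2 * d L'"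
      unfolding uu vv uv vu \<delta> by (simp add: d_def power2_eq_square algebra_simps)
    then have d: "d L = d L'" using r by simp
    consider "L = L'" | \<alpha> \<beta> where "L = B02 \<alpha>" "L' = B02 \<beta>" | \<alpha> where "L = B01" "L' = B02 \<alpha>"
      | \<alpha> where "L = B02 \<alpha>" "L' = B01" | \<alpha> where "L = B03" "L' = B02 \<alpha>"
      | \<alpha> where "L = B02 \<alpha>" "L' = B03" | "d L \<noteq> d L'"
      using side L by (cases L; cases L') (simp_all add: d_def axis_def)
    then show ?thesis
    proof cases
      case (2 \<alpha> \<beta>)
      then have "\<alpha>\<^sup>2 = \<beta>\<^sup>2" using d by (simp add: d_def axis_def power2_eq_square algebra_simps)
      then show ?thesis using 2 by (auto simp: power2_eq_iff)
    next
      case (3 \<alpha>)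
      then have "\<alpha> = 0" using d by (simp add: d_def axis_def algebra_simps)
      then show ?thesis using 3 vv r 1 by (simp add: axis_def algebra_simps)
    next
      case (4 \<alpha>)
      then have "u $ 3 = 0" "v $ 3 = 0" using uu vv 1 by (simp_all add: axis_def algebra_simps)
      then show ?thesis using \<delta> r by simp
    next
      case (5 \<alpha>)
      then have "\<alpha> = 1 \<or> \<alpha> = - 1"
        using d by (auto simp: d_def axis_def eq_neg_iff_add_eq_0)
      then show ?thesis
      proof
        assume "\<alpha> = 1"
        then have "e $ 2 * u $ 3 * 2 = r" "e $ 2 * v $ 3 = 0" "u $ 2 * u $ 3 = 0"
          using 5 eu ev uu 1 by (simp_all add: axis_def algebra_simps)
        then show ?thesis using \<delta> r 5 uv 1 \<open>\<alpha> = 1\<close> by (auto simp: axis_def)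
      next
        assume "\<alpha> = - 1"
        then have "e $ 3 * u $ 2 * - 2 = r" "e $ 3 * v $ 2 = 0" "u $ 2 * u $ 3 = 0"
          using 5 eu ev uu 1 by (simp_all add: axis_def algebra_simps)
        then show ?thesis using \<delta> r 5 uv 1 \<open>\<alpha> = - 1\<close> by (auto simp: axis_def)
      qed
    next
      case (6 \<alpha>)
      then have "u $ 2 + 2 * e $ 2 * u $ 3 = 0" "v $ 2 + 2 * e $ 2 * v $ 3 = 0"
        using eu ev 1 by (simp_all add: axis_def algebra_simps)
      then have "u $ 2 * v $ 3 - u $ 3 * v $ 2 = 0" by algebra
      then show ?thesis using \<delta> r by simp
    qed (use d in auto)
  qed
  ultimately show ?thesis by blast
qed

lemma mirror_mirror: "mirror (mirror L) = L"
  by (cases L) auto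

lemma isomorphic_labels_cases:
  assumes "isomorphic_algebras (*s) (listed_mult L) (*s) (listed_mult L')"
  shows "L = L' \<or> (\<exists>\<alpha>. L = B02 \<alpha> \<and> L' = B02 (- \<alpha>)) \<or> (\<exists>\<alpha>. L = B05 \<alpha> \<and> L' = B05 (- \<alpha>))"
proof -
  obtain r \<theta> where side: "side L = side L'" and iso: "form_iso L L' r \<theta>"
    using isomorphic_labels_form_iso[OF assms] .
  show ?thesis
  proof (cases "side L = 1")
    case True
    then show ?thesis using form_iso_left_labels[OF iso] side by auto
  next
    case False
    then have "side (mirror L) = 1" "side (mirror L') = 1"
      using side side_cases[of L] by (simp_all add: side_mirror)
    moreover obtain \<theta>' where "form_iso (mirror L) (mirror L') r \<theta>'"
      using form_iso_mirror[OF iso] by blast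
    ultimately have "mirror L = mirror L' \<or> (\<exists>\<alpha>. mirror L = B02 \<alpha> \<and> mirror L' = B02 (- \<alpha>))"
      by (intro form_iso_left_labels)
    then show ?thesis by (metis mirror.simps(2) mirror_mirror)
  qed
qed

lemma isomorphic_negated_parameter:
  "isomorphic_algebras (*s) (listed_mult (B02 \<alpha>)) (*s) (listed_mult (B02 (- \<alpha>)))"
  "isomorphic_algebras (*s) (listed_mult (B05 \<alpha>)) (*s) (listed_mult (B05 (- \<alpha>)))"
proof -
  \<comment> \<open>Exchanging e_2 and e_3 swaps \<alpha> + 1 with \<alpha> - 1; up to the sign
    absorbed by e_4 this is the pair belonging to -\<alpha>.\<close>
  let ?\<theta> = "lin4 (\<e> 1) (\<e> 3) (\<e> 2) (- \<e> 4)"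
  have bij: "bij ?\<theta>"
    by (rule bij_lin4) (auto simp: lin4_def vec_eq_iff forall_4 axis_def)
  have \<theta>: "?\<theta> x $ 1 = x $ 1" "?\<theta> x $ 2 = x $ 3" "?\<theta> x $ 3 = x $ 2" "?\<theta> x $ 4 = - x $ 4"
    "?\<theta> (\<e> 4) = - 1 *s \<e> 4" for x
    by (simp_all add: lin4_def axis_def vec_eq_iff)
  show "isomorphic_algebras (*s) (listed_mult (B02 \<alpha>)) (*s) (listed_mult (B02 (- \<alpha>)))"
    unfolding listed_mult_eq
    by (rule isomorphic_forms[OF label.form_algebra_axioms label.form_algebra_axioms linear_lin4 bij _ _ \<theta>(5)])
      (simp_all add: \<theta> algebra_simps)
  show "isomorphic_algebras (*s) (listed_mult (B05 \<alpha>)) (*s) (listed_mult (B05 (- \<alpha>)))"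
    unfolding listed_mult_eq
    by (rule isomorphic_forms[OF label.form_algebra_axioms label.form_algebra_axioms linear_lin4 bij _ _ \<theta>(5)])
      (simp_all add: \<theta> algebra_simps)
qed

theorem theorem20:
  shows "(\<forall>(scl :: complex \<Rightarrow> 'a::ab_group_add \<Rightarrow> 'a) mult.
            complex_algebra scl mult \<and> vector_space.dim scl UNIV = 4 \<and>
            binary_minus_one_one scl mult \<longrightarrow>
              minus_one_one_on UNIV mult \<or>
              (\<exists>L. isomorphic_algebras scl mult (*s) (listed_mult L))) \<and>
         (\<forall>L L'. isomorphic_algebras (*s) (listed_mult L) (*s) (listed_mult L') \<longleftrightarrow>
            L = L' \<or>
            (\<exists>\<alpha>. L = B02 \<alpha> \<and> L' = B02 (- \<alpha>)) \<or>
            (\<exists>\<alpha>. L = B05 \<alpha> \<and> L' = B05 (- \<alpha>)))"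
proof (intro conjI allI impI)
  fix scl :: "complex \<Rightarrow> 'a \<Rightarrow> 'a" and mult
  assume "complex_algebra scl mult \<and> vector_space.dim scl UNIV = 4 \<and> binary_minus_one_one scl mult"
  then show "minus_one_one_on UNIV mult \<or>
      (\<exists>L. isomorphic_algebras scl mult (*s) (listed_mult L))"
    using complex_algebra.exists_label by blast
next
  fix L L'
  have "isomorphic_algebras (*s) (listed_mult L) (*s) (listed_mult L)"
    unfolding listed_mult_def by (rule isomorphic_algebras_refl[OF complex_algebra_mult_of_table])
  then show "isomorphic_algebras (*s) (listed_mult L) (*s) (listed_mult L') \<longleftrightarrow>
      L = L' \<or> (\<exists>\<alpha>. L = B02 \<alpha> \<and> L' = B02 (- \<alpha>)) \<or> (\<exists>\<alpha>. L = B05 \<alpha> \<and> L' = B05 (- \<alpha>))"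
    using isomorphic_labels_cases isomorphic_negated_parameter by blast
qed

end
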